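(* Let $n\geq 1$ and let $f,g\colon \mathbb{R}^n\to[0,\infty)$ be non-negative measurable functions satisfying $$f(x)\,g(y)\leq \mathrm{e}^{-x\cdot y}\qquad \text{for all } x,y\in\mathbb{R}^n.$$ Assume that $f$ (or $g$) has its barycenter at $0$, that is, $\int_{\mathbb{R}^n} x f(x)\,dx=0$ (or $\int_{\mathbb{R}^n} x g(x)\,dx=0$). Then $$\int_{\mathbb{R}^n} f(x)\,dx\,\int_{\mathbb{R}^n} g(y)\,dy\leq (2\pi)^n.$$
   Context: Here $x\cdot y$ is the standard Euclidean inner product on $\mathbb{R}^n$, and $dx$, $dy$ denote Lebesgue measure. The integrals of the non-negative functions $f$ and $g$ are taken in $[0,\infty]$, with the usual measure-theoretic convention $0\cdot\infty=0$ for their product. The condition $\int_{\mathbb{R}^n} x f(x)\,dx=0$ is an equality of vectors in $\mathbb{R}^n$ and is understood to include that the integral makes sense, i.e. that $x\mapsto |x|f(x)$ is Lebesgue integrable (likewise for $g$). *)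

theory Defs
  imports "HOL-Analysis.Analysis"
begin

text \<open>
  The barycenter condition includes that the first moment makes sense. Without the first
  conjunct it would also hold for every non-integrable moment, because the Bochner integral
  of a non-integrable function is 0 by convention.
\<close>

definition barycenter_at_origin :: "(real ^ 'n \<Rightarrow> real) \<Rightarrow> bool" where
  "barycenter_at_origin f \<longleftrightarrow>
     integrable lebesgue (\<lambda>x. norm x * f x) \<and> (LINT x|lebesgue. f x *\<^sub>R x) = 0"

end

theory Submission
  imports Defs "HOL-Probability.Distributions" "HOL-Probability.Distribution_Functions"
begin

text \<open>
  Lehec's induction on the dimension. By symmetry the barycenter of \<open>g\<close> is at \<open>0\<close>, so by
  convexity of \<open>exp\<close> the integral of \<open>g\<close> does not decrease when \<open>g y\<close> is multiplied by
  \<open>exp (z \<bullet> y)\<close>; the induction only uses this property of \<open>g\<close>, and it allows us to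
  translate \<open>f\<close> by any \<open>z\<close>. No condition on \<open>f\<close> remains, so \<open>f\<close> may be truncated.

  Cut \<open>f\<close> into two halves of equal mass by a hyperplane orthogonal to a basis vector \<open>b\<close>.
  The line through the barycenters of the two halves, with direction \<open>v\<close>, meets the hyperplane
  in \<open>z\<close>. Integrating each half of \<open>f\<close> along \<open>v\<close> gives a function of one variable less
  whose barycenter is \<open>z\<close>, and integrating \<open>g\<close> along half-lines in direction \<open>b\<close> starting
  on the hyperplane orthogonal to \<open>v\<close> gives a function that is dual to it: this is the Prekopa-Leindler
  inequality in logarithmic coordinates, at the cost of a factor \<open>pi / 2\<close>. The induction
  hypothesis bounds the two products, and their sum is the claim.
\<close>

subsection \<open>Functions on the half-line\<close>

lemma emeasure_lborel_Ioi_0: "emeasure lborel {0 :: real <..} = top"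
proof (rule ccontr)
  assume "emeasure lborel {0 :: real <..} \<noteq> top"
  then obtain r where r: "emeasure lborel {0 :: real <..} = ennreal r" "r \<ge> 0"
    by (cases "emeasure lborel {0 :: real <..}") auto
  have "emeasure lborel {0 <.. r + 1} \<le> emeasure lborel {0 :: real <..}"
    by (rule emeasure_mono) auto
  with r show False by simp
qed

text \<open>Fubini, after writing each value \<open>h x\<close> as \<open>a\<close> times the length
  of the set of all \<open>l > 0\<close> with \<open>a * l < h x\<close>; the value
  \<open>top\<close> fits in because the half-line has infinite length. The free scale
  \<open>a\<close> lets functions with different suprema be compared at the same parameter
  \<open>l\<close>.\<close>

lemma nn_integral_layer_cake:
  fixes h :: "'a \<Rightarrow> ennreal" and a :: real
  assumes M: "sigma_finite_measure M" and h[measurable]: "h \<in> borel_measurable M" and a: "a > 0"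
  shows "(\<integral>\<^sup>+x. h x \<partial>M)
    = ennreal a * (\<integral>\<^sup>+l. emeasure M {x \<in> space M. ennreal (a * l) < h x} * indicator {0<..} l \<partial>lborel)"
proof -
  interpret M: sigma_finite_measure M by fact
  interpret P: pair_sigma_finite M "lborel :: real measure" ..
  have pt: "y = ennreal a * (\<integral>\<^sup>+l. indicator {l. 0 < l \<and> ennreal (a * l) < y} l \<partial>lborel)" for y :: ennreal
  proof (cases y)
    case (real r)
    have "{l. 0 < l \<and> ennreal (a * l) < y} = {0<..<r/a}"
      using real a by (auto simp: ennreal_less_iff field_simps)
    then have "(\<integral>\<^sup>+l. indicator {l. 0 < l \<and> ennreal (a * l) < y} l \<partial>lborel) = ennreal (r / a)"
      using real a by simp
    then show ?thesis using real a by (simp add: ennreal_mult[symmetric])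
  next
    case top
    have "{l. 0 < l \<and> ennreal (a * l) < y} = {0<..}"
      using top by auto
    then have "ennreal a * (\<integral>\<^sup>+l. indicator {l. 0 < l \<and> ennreal (a * l) < y} l \<partial>lborel) = top"
      using a by (simp add: emeasure_lborel_Ioi_0 ennreal_mult_top)
    then show ?thesis using top by simp
  qed
  have "(\<integral>\<^sup>+x. h x \<partial>M)
      = (\<integral>\<^sup>+x. ennreal a * (\<integral>\<^sup>+l. indicator {l. 0 < l \<and> ennreal (a * l) < h x} l \<partial>lborel) \<partial>M)"
    using pt by simp
  also have "\<dots> = ennreal a * (\<integral>\<^sup>+x. (\<integral>\<^sup>+l. indicator {l. 0 < l \<and> ennreal (a * l) < h x} l \<partial>lborel) \<partial>M)"
    by (rule nn_integral_cmult) measurable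
  also have "(\<integral>\<^sup>+x. (\<integral>\<^sup>+l. indicator {l. 0 < l \<and> ennreal (a * l) < h x} l \<partial>lborel) \<partial>M)
    = (\<integral>\<^sup>+l. (\<integral>\<^sup>+x. indicator {l. 0 < l \<and> ennreal (a * l) < h x} l \<partial>M) \<partial>lborel)"
    by (rule P.Fubini'[symmetric]) measurable
  also have "\<dots> = (\<integral>\<^sup>+l. emeasure M {x \<in> space M. ennreal (a * l) < h x} * indicator {0<..} l \<partial>lborel)"
  proof (intro nn_integral_cong)
    fix l :: real
    have "(\<integral>\<^sup>+x. indicator {l. 0 < l \<and> ennreal (a * l) < h x} l \<partial>M)
       = (\<integral>\<^sup>+x. indicator {0<..} l * indicator {x \<in> space M. ennreal (a * l) < h x} x \<partial>M)"
      by (intro nn_integral_cong) (auto split: split_indicator)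
    also have "\<dots> = indicator {0<..} l * emeasure M {x \<in> space M. ennreal (a * l) < h x}"
      by (subst nn_integral_cmult) auto
    finally show "(\<integral>\<^sup>+x. indicator {l. 0 < l \<and> ennreal (a * l) < h x} l \<partial>M)
      = emeasure M {x \<in> space M. ennreal (a * l) < h x} * indicator {0<..} l"
      by (simp add: mult.commute)
  qed
  finally show ?thesis .
qed

section \<open>The Brunn-Minkowski inequality on the real line\<close>

lemma emeasure_lborel_translate:
  fixes c :: "'a::euclidean_space"
  assumes [measurable]: "A \<in> sets borel"
  shows "emeasure lborel {z. z - c \<in> A} = emeasure lborel A"
proof -
  have "emeasure lborel A = emeasure (distr lborel borel ((+) (- c))) A"
    by (simp add: lborel_distr_plus)
  also have "\<dots> = emeasure lborel ((+) (- c) -` A)"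
    by (subst emeasure_distr) auto
  also have "(+) (- c) -` A = {z. z - c \<in> A}" by auto
  finally show ?thesis by simp
qed

text \<open>For \<open>a\<close> in \<open>A\<close> and \<open>b\<close> in \<open>B\<close>, the
  set \<open>D\<close> contains the translates \<open>A + b\<close> and \<open>a + B\<close>. If
  \<open>a\<close> is close to \<open>Sup A\<close> and \<open>b\<close> close to
  \<open>Inf B\<close>, these are disjoint up to pieces of total length \<open>e\<close> near
  \<open>a + b\<close>. A Borel set \<open>D\<close> containing the sumset is used because a sumset
  of Borel sets may fail to be Borel.\<close>

lemma Brunn_Minkowski_real_bounded:
  fixes A B D :: "real set"
  assumes [measurable]: "A \<in> sets borel" "B \<in> sets borel" "D \<in> sets borel"
    and ne: "A \<noteq> {}" "B \<noteq> {}" and bd: "bdd_above A" "bdd_below B"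
    and sub: "\<And>x y. x \<in> A \<Longrightarrow> y \<in> B \<Longrightarrow> x + y \<in> D"
  shows "emeasure lborel A + emeasure lborel B \<le> emeasure lborel D"
proof (rule ennreal_le_epsilon)
  fix e :: real assume e: "e > 0"
  obtain a where a: "a \<in> A" "Sup A - e/2 < a"
    using less_cSup_iff[OF ne(1) bd(1), of "Sup A - e/2"] e by auto
  obtain b where b: "b \<in> B" "b < Inf B + e/2"
    using cInf_less_iff[OF ne(2) bd(2), of "Inf B + e/2"] e by auto
  \<comment> \<open>The cut is strict at \<open>a\<close> and non-strict at \<open>b\<close>, so the
    translates of \<open>?A\<close> by \<open>b\<close> and of \<open>?B\<close> by \<open>a\<close>
    lie on different sides of \<open>a + b\<close> and do not share that point. Each cut costs at
    most \<open>e / 2\<close>.\<close>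
  let ?A = "A \<inter> {..<a}" and ?B = "B \<inter> {b..}"
  have "emeasure lborel A \<le> emeasure lborel (?A \<union> {a..Sup A})"
    using cSup_upper[OF _ bd(1)] by (intro emeasure_mono) auto
  also have "\<dots> \<le> emeasure lborel ?A + emeasure lborel {a..Sup A}"
    by (rule emeasure_subadditive) auto
  also have "emeasure lborel {a..Sup A} \<le> ennreal (e/2)"
    using a e by (auto simp: emeasure_lborel_Icc_eq intro!: ennreal_leI)
  finally have A: "emeasure lborel A \<le> emeasure lborel ?A + ennreal (e/2)" by auto
  have "emeasure lborel B \<le> emeasure lborel (?B \<union> {Inf B..b})"
    using cInf_lower[OF _ bd(2)] by (intro emeasure_mono) auto
  also have "\<dots> \<le> emeasure lborel ?B + emeasure lborel {Inf B..b}"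
    by (rule emeasure_subadditive) auto
  also have "emeasure lborel {Inf B..b} \<le> ennreal (e/2)"
    using b e by (auto simp: emeasure_lborel_Icc_eq intro!: ennreal_leI)
  finally have B: "emeasure lborel B \<le> emeasure lborel ?B + ennreal (e/2)" by auto
  have [measurable]: "{z. z - b \<in> ?A} \<in> sets borel" "{z. z - a \<in> ?B} \<in> sets borel"
    by measurable
  have "emeasure lborel ?A + emeasure lborel ?B
      = emeasure lborel {z. z - b \<in> ?A} + emeasure lborel {z. z - a \<in> ?B}"
    by (subst (1 2) emeasure_lborel_translate) auto
  also have "\<dots> = emeasure lborel ({z. z - b \<in> ?A} \<union> {z. z - a \<in> ?B})"
    by (rule plus_emeasure) auto
  also have "\<dots> \<le> emeasure lborel D"
  proof (rule emeasure_mono)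
    show "{z. z - b \<in> ?A} \<union> {z. z - a \<in> ?B} \<subseteq> D"
      using sub[OF _ b(1)] sub[OF a(1)] by force
  qed auto
  finally have D: "emeasure lborel ?A + emeasure lborel ?B \<le> emeasure lborel D" .
  have "emeasure lborel A + emeasure lborel B
     \<le> (emeasure lborel ?A + ennreal (e/2)) + (emeasure lborel ?B + ennreal (e/2))"
    by (rule add_mono[OF A B])
  also have "\<dots> = (emeasure lborel ?A + emeasure lborel ?B) + (ennreal (e/2) + ennreal (e/2))"
    by (simp only: ac_simps)
  also have "ennreal (e/2) + ennreal (e/2) = ennreal e"
    using e by (subst ennreal_plus[symmetric]) auto
  finally show "emeasure lborel A + emeasure lborel B \<le> emeasure lborel D + ennreal e"
    using D by (meson add_right_mono order_trans)
qed

lemma Brunn_Minkowski_real: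
  fixes A B D :: "real set"
  assumes [measurable]: "A \<in> sets borel" "B \<in> sets borel" "D \<in> sets borel"
    and ne: "A \<noteq> {}" "B \<noteq> {}"
    and sub: "\<And>x y. x \<in> A \<Longrightarrow> y \<in> B \<Longrightarrow> x + y \<in> D"
  shows "emeasure lborel A + emeasure lborel B \<le> emeasure lborel D"
proof -
  obtain a b where ab: "a \<in> A" "b \<in> B" using ne by auto
  define I where "I k = {- real k .. real k}" for k :: nat
  have lim: "(\<lambda>k. emeasure lborel (S \<inter> I k)) \<longlonglongrightarrow> emeasure lborel S" if [measurable]: "S \<in> sets borel" for S
  proof -
    have "(\<Union>k. S \<inter> I k) = S"
    proof safe
      fix x assume "x \<in> S"
      moreover obtain k where "\<bar>x\<bar> \<le> real k" using real_arch_simple by blast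
      ultimately show "x \<in> (\<Union>k. S \<inter> I k)" by (auto simp: I_def intro!: exI[of _ k])
    qed
    moreover have "(\<lambda>k. emeasure lborel (S \<inter> I k)) \<longlonglongrightarrow> emeasure lborel (\<Union>k. S \<inter> I k)"
      by (rule Lim_emeasure_incseq) (auto simp: I_def incseq_def)
    ultimately show ?thesis by metis
  qed
  \<comment> \<open>From index \<open>K\<close> on, the truncations still contain \<open>a\<close>
    and \<open>b\<close>, so both are nonempty as the bounded case requires.\<close>
  obtain K where K: "\<bar>a\<bar> \<le> real K" "\<bar>b\<bar> \<le> real K"
    using real_arch_simple[of "max \<bar>a\<bar> \<bar>b\<bar>"] by auto
  have "\<forall>k\<ge>K. emeasure lborel (A \<inter> I k) + emeasure lborel (B \<inter> I k) \<le> emeasure lborel D"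
  proof safe
    fix k assume "k \<ge> K"
    then have "a \<in> A \<inter> I k" "b \<in> B \<inter> I k" using ab K by (auto simp: I_def)
    moreover have "bdd_above (A \<inter> I k)" "bdd_below (B \<inter> I k)"
      by (auto simp: I_def)
    moreover have "I k \<in> sets borel" by (simp add: I_def)
    ultimately show "emeasure lborel (A \<inter> I k) + emeasure lborel (B \<inter> I k) \<le> emeasure lborel D"
      by (intro Brunn_Minkowski_real_bounded) (auto intro: sub)
  qed
  moreover have "(\<lambda>k. emeasure lborel (A \<inter> I k) + emeasure lborel (B \<inter> I k))
     \<longlonglongrightarrow> emeasure lborel A + emeasure lborel B"
    by (intro tendsto_add lim) auto
  ultimately show ?thesis by (intro LIMSEQ_le_const2) auto
qed

lemma Brunn_Minkowski_real_midpoint: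
  fixes A B D :: "real set"
  assumes [measurable]: "A \<in> sets borel" "B \<in> sets borel" "D \<in> sets borel"
    and ne: "A \<noteq> {}" "B \<noteq> {}"
    and sub: "\<And>x y. x \<in> A \<Longrightarrow> y \<in> B \<Longrightarrow> (x + y) / 2 \<in> D"
  shows "emeasure lborel A + emeasure lborel B \<le> 2 * emeasure lborel D"
proof -
  have "emeasure lborel A + emeasure lborel B \<le> emeasure lborel {z. z / 2 \<in> D}"
    using ne sub by (intro Brunn_Minkowski_real) auto
  also have "\<dots> = (\<integral>\<^sup>+z. indicator {z. z / 2 \<in> D} z \<partial>lborel)"
    by simp
  also have "\<dots> = (\<integral>\<^sup>+z. indicator D (z / 2) \<partial>lborel)"
    by (intro nn_integral_cong) (simp add: indicator_def)
  also have "\<dots> = 2 * emeasure lborel D"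
    by (subst nn_integral_real_affine[where c=2 and t=0]) auto
  finally show ?thesis .
qed

section \<open>The Prekopa-Leindler inequality on the real line\<close>

lemma ennreal_mult_le_square_mean:
  fixes x y z :: ennreal
  assumes "x + y \<le> 2 * z"
  shows "x * y \<le> z\<^sup>2"
proof (cases z)
  case top
  then show ?thesis by (simp add: power2_eq_square)
next
  case (real c)
  have "x + y \<le> ennreal (2 * c)" using assms real by (simp add: ennreal_mult)
  then have "x + y < top" by (rule le_less_trans) simp
  then obtain a b where ab: "x = ennreal a" "a \<ge> 0" "y = ennreal b" "b \<ge> 0"
    by (cases x; cases y) auto
  have "ennreal (a + b) \<le> ennreal (2 * c)"
    using assms ab real by (simp add: ennreal_mult)
  then have "a + b \<le> 2 * c" using real ab by (subst (asm) ennreal_le_iff) auto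
  then have "(a + b)\<^sup>2 \<le> (2 * c)\<^sup>2" using ab by (intro power_mono) auto
  moreover have "0 \<le> (a - b)\<^sup>2" by simp
  ultimately have "a * b \<le> c\<^sup>2" by (simp add: power2_eq_square algebra_simps)
  then show ?thesis using ab real by (simp add: ennreal_mult[symmetric] ennreal_power ennreal_leI)
qed

text \<open>Brunn-Minkowski compares the level sets of the three functions level by level. The
  layer-cake formula integrates this to a bound on the sum of the two normalised integrals, and the
  inequality of arithmetic and geometric means turns the sum into a product. The bound on
  \<open>h3\<close> makes the suprema of \<open>h1\<close> and \<open>h2\<close> finite, so that
  both functions can be normalised.\<close>

lemma Prekopa_Leindler_real_midpoint:
  fixes h1 h2 h3 :: "real \<Rightarrow> ennreal"
  assumes [measurable]: "h1 \<in> borel_measurable borel" "h2 \<in> borel_measurable borel" "h3 \<in> borel_measurable borel"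
    and le: "\<And>x y. h1 x * h2 y \<le> (h3 ((x + y) / 2))\<^sup>2"
    and bd: "\<And>x. h3 x \<le> ennreal K"
  shows "(\<integral>\<^sup>+x. h1 x \<partial>lborel) * (\<integral>\<^sup>+x. h2 x \<partial>lborel) \<le> (\<integral>\<^sup>+x. h3 x \<partial>lborel)\<^sup>2"
proof (cases "(\<forall>x. h1 x = 0) \<or> (\<forall>x. h2 x = 0)")
  case True
  then show ?thesis by auto
next
  case False
  then obtain x0 y0 where pos: "h1 x0 > 0" "h2 y0 > 0" by (auto simp: zero_less_iff_neq_zero)
  have K: "h1 x * h2 y \<le> ennreal K ^ 2" for x y
    using le[of x y] power_mono[OF bd, of "(x + y) / 2" 2] by auto
  \<comment> \<open>All products are bounded, so one positive value \<open>h2 y0\<close> forces the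
    supremum of \<open>h1\<close> to be finite; \<open>h1 x0\<close> does the same for
    \<open>h2\<close>.\<close>
  have "(SUP x. h1 x) * h2 y0 \<le> ennreal K ^ 2"
    unfolding SUP_mult_right_ennreal using K by (auto intro: SUP_least)
  moreover have "ennreal K ^ 2 < top" by (simp add: power_less_top_ennreal)
  ultimately have "(SUP x. h1 x) * h2 y0 < top" by (rule le_less_trans)
  then have 1: "(SUP x. h1 x) < top" using pos by (auto simp: ennreal_mult_less_top)
  have "h1 x0 * (SUP x. h2 x) \<le> ennreal K ^ 2"
    unfolding SUP_mult_left_ennreal using K by (auto intro: SUP_least)
  then have "h1 x0 * (SUP x. h2 x) < top" by (rule le_less_trans) (simp add: power_less_top_ennreal)
  then have 2: "(SUP x. h2 x) < top" using pos by (auto simp: ennreal_mult_less_top)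
  have p: "0 < (SUP x. h1 x)" "0 < (SUP x. h2 x)"
    using pos by (auto simp: less_SUP_iff)
  obtain a where a: "(SUP x. h1 x) = ennreal a" "a > 0"
    using 1 p(1) by (cases "SUP x. h1 x") auto
  obtain b where b: "(SUP x. h2 x) = ennreal b" "b > 0"
    using 2 p(2) by (cases "SUP x. h2 x") auto
  \<comment> \<open>With this geometric mean the square of the level \<open>c * l\<close> is the
    product of the levels \<open>a * l\<close> and \<open>b * l\<close>, so points above the latter
    two have their midpoint above the first.\<close>
  define c where "c = sqrt (a * b)"
  have c: "c > 0" "c\<^sup>2 = a * b" using a b by (auto simp: c_def)
  \<comment> \<open>Scaling \<open>h1\<close> and \<open>h2\<close> by their suprema makes their level sets nonempty for the same
    levels \<open>l < 1\<close>; Brunn-Minkowski fails for empty sets.\<close>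
  define L where "L h d l = emeasure lborel {x. ennreal (d * l) < h x} * indicator {0<..} l"
    for h :: "real \<Rightarrow> ennreal" and d l :: real
  have cake: "(\<integral>\<^sup>+x. h x \<partial>lborel) = ennreal d * (\<integral>\<^sup>+l. L h d l \<partial>lborel)"
    if "h \<in> borel_measurable borel" "d > 0" for h d
    unfolding L_def using nn_integral_layer_cake[OF sigma_finite_lborel, of h d] that by simp
  have Lm: "L h d \<in> borel_measurable borel" if [measurable]: "h \<in> borel_measurable borel" for h d
  proof -
    have "(\<lambda>l. (\<integral>\<^sup>+x. indicator {x. ennreal (d * l) < h x} x \<partial>lborel) * indicator {0<..} l) \<in> borel_measurable borel"
      by measurable
    also have "(\<lambda>l. (\<integral>\<^sup>+x. indicator {x. ennreal (d * l) < h x} x \<partial>lborel) * indicator {0<..} l) = L h d"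
      unfolding L_def by (intro ext) simp
    finally show ?thesis .
  qed
  have level: "L h1 a l + L h2 b l \<le> 2 * L h3 c l" for l
  proof (cases "0 < l \<and> l < 1")
    case True
    have "ennreal (a * l) < (SUP x. h1 x)" "ennreal (b * l) < (SUP x. h2 x)"
      using True a b by (auto simp: ennreal_less_iff)
    then have ne: "{x. ennreal (a * l) < h1 x} \<noteq> {}" "{x. ennreal (b * l) < h2 x} \<noteq> {}"
      by (auto simp: less_SUP_iff)
    have "emeasure lborel {x. ennreal (a * l) < h1 x} + emeasure lborel {x. ennreal (b * l) < h2 x}
      \<le> 2 * emeasure lborel {x. ennreal (c * l) < h3 x}"
    proof (rule Brunn_Minkowski_real_midpoint[OF _ _ _ ne])
      fix x y assume "x \<in> {x. ennreal (a * l) < h1 x}" "y \<in> {x. ennreal (b * l) < h2 x}"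
      then have *: "ennreal (a * l) < h1 x" "ennreal (b * l) < h2 y" by auto
      have "ennreal (a * l) * ennreal (b * l) < h1 x * ennreal (b * l)"
        using * True b by (intro ennreal_mult_strict_right_mono) auto
      also have "\<dots> \<le> h1 x * h2 y" using * by (intro mult_left_mono) auto
      also have "\<dots> \<le> (h3 ((x + y) / 2))\<^sup>2" by (rule le)
      finally have *: "ennreal (a * l) * ennreal (b * l) < (h3 ((x + y) / 2))\<^sup>2" .
      have "ennreal (c * l) < h3 ((x + y) / 2)"
      proof (rule ccontr)
        assume "\<not> ennreal (c * l) < h3 ((x + y) / 2)"
        then have "(h3 ((x + y) / 2))\<^sup>2 \<le> (ennreal (c * l))\<^sup>2"
          by (intro power_mono) auto
        also have "\<dots> = ennreal (a * l) * ennreal (b * l)"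
          using a b c True by (simp add: ennreal_power ennreal_mult[symmetric] power_mult_distrib)
            (simp add: power2_eq_square algebra_simps)
        finally show False using * by auto
      qed
      then show "(x + y) / 2 \<in> {x. ennreal (c * l) < h3 x}" by simp
    qed auto
    then show ?thesis using True by (simp add: L_def)
  next
    case False
    \<comment> \<open>For \<open>l \<ge> 1\<close> the levels have reached the suprema and the level
      sets on the left are empty; for \<open>l \<le> 0\<close> the indicator in \<open>L\<close>
      vanishes.\<close>
    have "{x. ennreal (a * l) < h1 x} = {}" if "l \<ge> 1"
    proof -
      have "h1 x \<le> ennreal (a * l)" for x
        using SUP_upper[of x UNIV h1] that a
        by (auto intro!: order_trans[OF _ ennreal_leI[of a "a * l"]])
      then show ?thesis by (auto simp: not_less)
    qed
    moreover have "{x. ennreal (b * l) < h2 x} = {}" if "l \<ge> 1"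
    proof -
      have "h2 x \<le> ennreal (b * l)" for x
        using SUP_upper[of x UNIV h2] that b
        by (auto intro!: order_trans[OF _ ennreal_leI[of b "b * l"]])
      then show ?thesis by (auto simp: not_less)
    qed
    ultimately show ?thesis using False by (auto simp: L_def indicator_def)
  qed
  let ?I = "\<lambda>h d. \<integral>\<^sup>+l. L h d l \<partial>lborel"
  have "?I h1 a + ?I h2 b = (\<integral>\<^sup>+l. L h1 a l + L h2 b l \<partial>lborel)"
    using Lm by (subst nn_integral_add) auto
  also have "\<dots> \<le> (\<integral>\<^sup>+l. 2 * L h3 c l \<partial>lborel)"
    by (intro nn_integral_mono level)
  also have "\<dots> = 2 * ?I h3 c"
    using Lm by (subst nn_integral_cmult) auto
  finally have "?I h1 a * ?I h2 b \<le> (?I h3 c)\<^sup>2"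
    by (rule ennreal_mult_le_square_mean)
  then have "(ennreal a * ennreal b) * (?I h1 a * ?I h2 b) \<le> (ennreal c)\<^sup>2 * (?I h3 c)\<^sup>2"
    using a b c by (intro mult_mono) (auto simp: ennreal_power ennreal_mult)
  then show ?thesis
    unfolding cake[OF assms(1) a(2)] cake[OF assms(2) b(2)] cake[OF assms(3) c(1)]
    by (simp only: power_mult_distrib mult_ac)
qed

section \<open>Duality on the half-line in logarithmic coordinates\<close>

lemma nn_integral_exp_substitution:
  fixes p :: "real \<Rightarrow> ennreal"
  assumes [measurable]: "p \<in> borel_measurable borel"
  shows "(\<integral>\<^sup>+x. p x * indicator {0<..} x \<partial>lborel) = (\<integral>\<^sup>+u. p (exp u) * ennreal (exp u) \<partial>lborel)"
proof -
  \<comment> \<open>The substitution is made on compact intervals that exhaust the line and the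
    half-line, followed by monotone convergence. \<open>Suc k\<close> keeps the intervals
    non-degenerate at \<open>k = 0\<close>.\<close>
  define I where "I k = {- real (Suc k) .. real (Suc k)}" for k
  define J where "J k = {exp (- real (Suc k)) .. exp (real (Suc k))}" for k
  have eq: "(\<integral>\<^sup>+x. p x * indicator (J k) x \<partial>lborel) = (\<integral>\<^sup>+u. p (exp u) * ennreal (exp u) * indicator (I k) u \<partial>lborel)" for k
    unfolding I_def J_def
    by (rule nn_integral_substitution_aux) (auto intro!: derivative_eq_intros continuous_intros)
  have evI: "eventually (\<lambda>k. u \<in> I k) sequentially" for u
  proof -
    obtain n where n: "\<bar>u\<bar> \<le> real n" using real_arch_simple by blast
    show ?thesis using eventually_ge_at_top[of n]
      by eventually_elim (use n in \<open>auto simp: I_def\<close>)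
  qed
  have J_iff: "x \<in> J k \<longleftrightarrow> x > 0 \<and> ln x \<in> I k" for x k
  proof (cases "x > 0")
    case True
    then have "x = exp (ln x)" by simp
    then show ?thesis using True unfolding J_def I_def by (metis atLeastAtMost_iff exp_le_cancel_iff)
  qed (auto simp: J_def dest: order_trans[OF exp_ge_zero] less_le_trans[OF exp_gt_zero])
  have mono: "I k \<subseteq> I l" "J k \<subseteq> J l" if "k \<le> l" for k l
    using that by (auto simp: I_def J_iff)
  have "(\<lambda>k. \<integral>\<^sup>+x. p x * indicator (J k) x \<partial>lborel) \<longlonglongrightarrow> (\<integral>\<^sup>+x. p x * indicator {0<..} x \<partial>lborel)"
  proof (rule nn_integral_LIMSEQ)
    show "incseq (\<lambda>k x. p x * indicator (J k) x)"
      using mono(2) by (auto simp: incseq_def le_fun_def split: split_indicator)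
    fix x :: real
    have "eventually (\<lambda>k. p x * indicator (J k) x = p x * indicator {0<..} x) sequentially"
    proof (cases "x > 0")
      case True
      then show ?thesis using evI[of "ln x"] by (auto elim!: eventually_mono simp: J_iff)
    qed (auto simp: J_iff)
    then show "(\<lambda>k. p x * indicator (J k) x) \<longlonglongrightarrow> p x * indicator {0<..} x"
      by (rule tendsto_eventually)
  qed (auto simp: J_def)
  moreover have "(\<lambda>k. \<integral>\<^sup>+x. p x * indicator (J k) x \<partial>lborel) \<longlonglongrightarrow> (\<integral>\<^sup>+u. p (exp u) * ennreal (exp u) \<partial>lborel)"
    unfolding eq
  proof (rule nn_integral_LIMSEQ)
    show "incseq (\<lambda>k u. p (exp u) * ennreal (exp u) * indicator (I k) u)"
      using mono(1) by (auto simp: incseq_def le_fun_def split: split_indicator)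
    fix u :: real
    show "(\<lambda>k. p (exp u) * ennreal (exp u) * indicator (I k) u) \<longlonglongrightarrow> p (exp u) * ennreal (exp u)"
      using evI[of u] by (intro tendsto_eventually) (auto elim!: eventually_mono)
  qed (auto simp: I_def)
  ultimately show ?thesis by (rule LIMSEQ_unique)
qed

lemma nn_integral_half_Gaussian:
  "(\<integral>\<^sup>+x. ennreal (exp (- x\<^sup>2 / 2)) * indicator {0<..} x \<partial>lborel) = ennreal (sqrt (pi / 2))"
proof -
  have "(\<integral>\<^sup>+x. ennreal (exp (- x\<^sup>2)) * indicator {0<..} x \<partial>lborel)
    = (\<integral>\<^sup>+x. ennreal (indicator {0..} x *\<^sub>R exp (- x\<^sup>2)) \<partial>lborel)"
    using AE_lborel_singleton[of "0::real"]
    by (intro nn_integral_cong_AE) (auto split: split_indicator)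
  also have "\<dots> = ennreal (sqrt pi / 2)"
    by (intro nn_integral_eq_integral[THEN trans])
      (use gaussian_moment_0 in \<open>auto simp: has_bochner_integral_iff\<close>)
  finally have *: "(\<integral>\<^sup>+x. ennreal (exp (- x\<^sup>2)) * indicator {0<..} x \<partial>lborel) = ennreal (sqrt pi / 2)" .
  have "(\<integral>\<^sup>+x. ennreal (exp (- x\<^sup>2 / 2)) * indicator {0<..} x \<partial>lborel)
    = ennreal (sqrt 2) * (\<integral>\<^sup>+x. ennreal (exp (- x\<^sup>2)) * indicator {0<..} x \<partial>lborel)"
    by (subst nn_integral_real_affine[where c="sqrt 2" and t=0])
      (auto simp: power_mult_distrib indicator_def zero_less_mult_iff intro!: arg_cong2[where f="(*)"] nn_integral_cong)
  also have "\<dots> = ennreal (sqrt (pi / 2))"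
    unfolding * by (subst ennreal_mult[symmetric]) (auto simp: real_sqrt_divide field_simps)
  finally show ?thesis .
qed

text \<open>For \<open>s = exp x\<close> and \<open>t = exp y\<close>, the exponential of the
  midpoint of \<open>x\<close> and \<open>y\<close> is the geometric mean of \<open>s\<close> and
  \<open>t\<close>. Hence \<open>C * exp (- (s * t))\<close> times the Jacobians
  \<open>s * t\<close> is the square of a function of the midpoint, and Prekopa-Leindler applies.
  The bound is \<open>C\<close> times the square of the half-line Gaussian integral
  \<open>sqrt (pi / 2)\<close>.\<close>

lemma nn_integral_half_line_duality:
  fixes p q :: "real \<Rightarrow> ennreal"
  assumes [measurable]: "p \<in> borel_measurable borel" "q \<in> borel_measurable borel"
    and C: "C \<ge> 0"
    and le: "\<And>s t. s > 0 \<Longrightarrow> t > 0 \<Longrightarrow> p s * q t \<le> ennreal (C * exp (- (s * t)))"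
  shows "(\<integral>\<^sup>+s. p s * indicator {0<..} s \<partial>lborel) * (\<integral>\<^sup>+t. q t * indicator {0<..} t \<partial>lborel)
    \<le> ennreal (C * (pi / 2))"
proof -
  define r where "r t = ennreal (sqrt C * exp (- t\<^sup>2 / 2))" for t
  have [measurable]: "r \<in> borel_measurable borel" unfolding r_def by measurable
  have sq: "(r (exp ((x + y) / 2)) * ennreal (exp ((x + y) / 2)))\<^sup>2
    = ennreal (C * exp (- (exp x * exp y))) * ennreal (exp x * exp y)" for x y
  proof -
    have e: "(exp ((x + y) / 2))\<^sup>2 = exp x * exp y"
      by (simp add: power2_eq_square exp_add[symmetric])
    have "(r (exp ((x + y) / 2)) * ennreal (exp ((x + y) / 2)))\<^sup>2
      = ennreal ((sqrt C * exp (- (exp x * exp y) / 2))\<^sup>2 * (exp ((x + y) / 2))\<^sup>2)"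
      unfolding r_def e using C by (simp add: ennreal_power ennreal_mult[symmetric] power_mult_distrib e)
    also have "(sqrt C * exp (- (exp x * exp y) / 2))\<^sup>2 = C * exp (- (exp x * exp y))"
      using C by (simp add: power_mult_distrib exp_double[symmetric])
    also note e
    finally show ?thesis using C by (simp add: ennreal_mult)
  qed
  have "(\<integral>\<^sup>+s. p s * indicator {0<..} s \<partial>lborel) * (\<integral>\<^sup>+t. q t * indicator {0<..} t \<partial>lborel)
    \<le> (\<integral>\<^sup>+u. r (exp u) * ennreal (exp u) \<partial>lborel)\<^sup>2"
    unfolding nn_integral_exp_substitution[OF assms(1)] nn_integral_exp_substitution[OF assms(2)]
  proof (rule Prekopa_Leindler_real_midpoint[where K = "sqrt C"])
    fix x y
    have "p (exp x) * ennreal (exp x) * (q (exp y) * ennreal (exp y))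
       = (p (exp x) * q (exp y)) * ennreal (exp x * exp y)"
      by (simp add: ennreal_mult mult_ac)
    also have "\<dots> \<le> ennreal (C * exp (- (exp x * exp y))) * ennreal (exp x * exp y)"
      by (intro mult_mono le) auto
    finally show "p (exp x) * ennreal (exp x) * (q (exp y) * ennreal (exp y))
      \<le> (r (exp ((x + y) / 2)) * ennreal (exp ((x + y) / 2)))\<^sup>2" unfolding sq .
  next
    fix x :: real
    \<comment> \<open>Prekopa-Leindler asks for a bounded third function; here
      \<open>t \<le> 1 + t^2 / 2 \<le> exp (t^2 / 2)\<close> gives the bound
      \<open>sqrt C\<close>.\<close>
    define t where "t = exp x"
    have "0 \<le> (t - 1)\<^sup>2" by simp
    then have "t \<le> 1 + t\<^sup>2 / 2" by (simp add: power2_eq_square algebra_simps)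
    also have "\<dots> \<le> exp (t\<^sup>2 / 2)" by (rule exp_ge_add_one_self)
    finally have "exp (- t\<^sup>2 / 2) * t \<le> exp (- t\<^sup>2 / 2) * exp (t\<^sup>2 / 2)"
      by (intro mult_left_mono) auto
    also have "\<dots> = 1" by (simp add: exp_add[symmetric])
    finally have "sqrt C * (exp (- t\<^sup>2 / 2) * t) \<le> sqrt C * 1"
      using C by (intro mult_left_mono) auto
    moreover have "r (exp x) * ennreal (exp x) = ennreal (sqrt C * (exp (- t\<^sup>2 / 2) * t))"
      unfolding r_def t_def using C by (simp add: ennreal_mult[symmetric] mult.assoc)
    ultimately show "r (exp x) * ennreal (exp x) \<le> ennreal (sqrt C)"
      by (auto intro: ennreal_leI)
  qed measurable
  also have "(\<integral>\<^sup>+u. r (exp u) * ennreal (exp u) \<partial>lborel)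
      = (\<integral>\<^sup>+t. r t * indicator {0<..} t \<partial>lborel)"
    by (rule nn_integral_exp_substitution[symmetric]) measurable
  also have "\<dots> = ennreal (sqrt C) * ennreal (sqrt (pi / 2))"
    unfolding nn_integral_half_Gaussian[symmetric] r_def using C
    by (subst nn_integral_cmult[symmetric]) (auto simp: ennreal_mult mult.assoc)
  also have "(ennreal (sqrt C) * ennreal (sqrt (pi / 2)))\<^sup>2 = ennreal (C * (pi / 2))"
    using C by (simp add: ennreal_power ennreal_mult[symmetric] power_mult_distrib)
  finally show ?thesis .
qed

subsection \<open>Lebesgue measure on coordinate subspaces\<close>

text \<open>For a set \<open>B\<close> of basis vectors this is their span. It is a set inside a
  fixed type, so that the dimension can vary in an induction over \<open>B\<close>.\<close>

definition coord_space :: "'a::euclidean_space set \<Rightarrow> 'a set" where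
  "coord_space B = {x. \<forall>e\<in>Basis - B. x \<bullet> e = 0}"

text \<open>For \<open>B\<close> a set of basis vectors, this is Lebesgue measure of dimension
  \<open>card B\<close>, kept as a measure on the whole space that is concentrated on
  \<open>coord_space B\<close>.\<close>

definition coord_lborel :: "'a::euclidean_space set \<Rightarrow> 'a measure" where
  "coord_lborel B = distr (\<Pi>\<^sub>M b\<in>B. lborel) borel (\<lambda>p. \<Sum>b\<in>B. p b *\<^sub>R b)"

lemma sets_coord_lborel [simp, measurable_cong]: "sets (coord_lborel B) = sets borel"
  and space_coord_lborel [simp]: "space (coord_lborel B) = UNIV"
  by (simp_all add: coord_lborel_def)

lemma coord_lborel_Basis: "coord_lborel Basis = lborel"
  unfolding coord_lborel_def by (rule lborel_eq[symmetric])

lemma coord_space_add: "x \<in> coord_space B \<Longrightarrow> y \<in> coord_space B \<Longrightarrow> x + y \<in> coord_space B"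
  and coord_space_scaleR: "x \<in> coord_space B \<Longrightarrow> c *\<^sub>R x \<in> coord_space B"
  and coord_space_mono: "B \<subseteq> B' \<Longrightarrow> coord_space B \<subseteq> coord_space B'"
  by (auto simp: coord_space_def inner_add_left)

lemma coord_space_basis_vector: "b \<in> Basis \<Longrightarrow> b \<in> B \<Longrightarrow> b \<in> coord_space B"
  by (auto simp: coord_space_def inner_Basis)

lemma coord_space_orthogonal: "x \<in> coord_space B \<Longrightarrow> b \<in> Basis \<Longrightarrow> b \<notin> B \<Longrightarrow> x \<bullet> b = 0"
  by (auto simp: coord_space_def)

lemma coord_space_insert_remove:
  "b \<in> Basis \<Longrightarrow> x \<in> coord_space (insert b B) \<Longrightarrow> x - (x \<bullet> b) *\<^sub>R b \<in> coord_space B"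
  by (auto simp: coord_space_def inner_diff_left inner_Basis)

lemma borel_coord_space [measurable]: "coord_space B \<in> sets borel"
proof -
  have "closed (\<Inter>e\<in>Basis - B. {x. e \<bullet> x = 0})"
    by (intro closed_INT ballI closed_hyperplane)
  also have "(\<Inter>e\<in>Basis - B. {x. e \<bullet> x = 0}) = coord_space B"
    by (auto simp: coord_space_def inner_commute)
  finally show ?thesis by simp
qed

lemma measurable_coord_sum [measurable]:
  "(\<lambda>p. \<Sum>b\<in>B. p b *\<^sub>R (b :: 'a::euclidean_space)) \<in> borel_measurable (\<Pi>\<^sub>M b\<in>B. lborel)"
proof (intro borel_measurable_sum borel_measurable_scaleR borel_measurable_const)
  fix b assume "b \<in> B"
  then show "(\<lambda>p. p b) \<in> borel_measurable (\<Pi>\<^sub>M b\<in>B. (lborel :: real measure))"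
    using measurable_component_singleton[of b B "\<lambda>_. lborel :: real measure"] by simp
qed

lemma nn_integral_coord_lborel:
  "f \<in> borel_measurable borel \<Longrightarrow>
    (\<integral>\<^sup>+x. f x \<partial>coord_lborel B) = (\<integral>\<^sup>+p. f (\<Sum>b\<in>B. p b *\<^sub>R b) \<partial>(\<Pi>\<^sub>M b\<in>B. lborel))"
  unfolding coord_lborel_def by (rule nn_integral_distr) auto

lemma AE_coord_lborel: 
  assumes "B \<subseteq> Basis"
  shows "AE x in coord_lborel B. x \<in> coord_space B"
proof -
  have "(\<Sum>b\<in>B. p b *\<^sub>R b) \<in> coord_space B" for p :: "'a \<Rightarrow> real"
    using assms by (auto simp: coord_space_def inner_sum_left inner_Basis subset_iff intro!: sum.neutral)
  then show ?thesis unfolding coord_lborel_def by (subst AE_distr_iff) auto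
qed

lemma nn_integral_coord_lborel_empty:
  "f \<in> borel_measurable borel \<Longrightarrow> (\<integral>\<^sup>+x. f x \<partial>coord_lborel {}) = f 0"
  by (simp add: nn_integral_coord_lborel PiM_empty nn_integral_count_space_finite)

interpretation lborel_family: product_sigma_finite "\<lambda>_ :: 'a. lborel :: real measure"
  by standard

lemma nn_integral_coord_lborel_insert:
  fixes b :: "'a::euclidean_space"
  assumes [measurable]: "f \<in> borel_measurable borel" and B: "finite B" "b \<notin> B"
  shows "(\<integral>\<^sup>+x. f x \<partial>coord_lborel (insert b B))
    = (\<integral>\<^sup>+x. (\<integral>\<^sup>+s. f (x + s *\<^sub>R b) \<partial>lborel) \<partial>coord_lborel B)"
proof -
  have "(\<integral>\<^sup>+x. f x \<partial>coord_lborel (insert b B))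
    = (\<integral>\<^sup>+p. (\<integral>\<^sup>+s. f (\<Sum>c\<in>insert b B. (p(b := s)) c *\<^sub>R c) \<partial>lborel) \<partial>(\<Pi>\<^sub>M c\<in>B. lborel))"
    unfolding nn_integral_coord_lborel[OF assms(1)]
    by (rule lborel_family.product_nn_integral_insert[OF B]) measurable
  also have "\<dots> = (\<integral>\<^sup>+p. (\<integral>\<^sup>+s. f ((\<Sum>c\<in>B. p c *\<^sub>R c) + s *\<^sub>R b) \<partial>lborel) \<partial>(\<Pi>\<^sub>M c\<in>B. lborel))"
  proof (intro nn_integral_cong)
    fix p :: "'a \<Rightarrow> real" and s :: real
    have "(\<Sum>c\<in>insert b B. (p(b := s)) c *\<^sub>R c) = s *\<^sub>R b + (\<Sum>c\<in>B. (p(b := s)) c *\<^sub>R c)"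
      using B by simp
    also have "(\<Sum>c\<in>B. (p(b := s)) c *\<^sub>R c) = (\<Sum>c\<in>B. p c *\<^sub>R c)"
      using B by (intro sum.cong) auto
    finally show "f (\<Sum>c\<in>insert b B. (p(b := s)) c *\<^sub>R c) = f ((\<Sum>c\<in>B. p c *\<^sub>R c) + s *\<^sub>R b)"
      by (simp add: add.commute)
  qed
  also have "\<dots> = (\<integral>\<^sup>+x. (\<integral>\<^sup>+s. f (x + s *\<^sub>R b) \<partial>lborel) \<partial>coord_lborel B)"
    by (subst nn_integral_coord_lborel) auto
  finally show ?thesis .
qed

text \<open>Fubini is applied to the product measure of which \<open>coord_lborel B\<close> is the
  image, where sigma-finiteness is at hand.\<close>

lemma nn_integral_coord_lborel_swap:
  fixes h :: "'a::euclidean_space \<Rightarrow> real \<Rightarrow> ennreal"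
  assumes [measurable]: "case_prod h \<in> borel_measurable (borel \<Otimes>\<^sub>M borel)" and B: "finite B"
  shows "(\<integral>\<^sup>+x. (\<integral>\<^sup>+s. h x s \<partial>lborel) \<partial>coord_lborel B) = (\<integral>\<^sup>+s. (\<integral>\<^sup>+x. h x s \<partial>coord_lborel B) \<partial>lborel)"
proof -
  interpret P: sigma_finite_measure "\<Pi>\<^sub>M (c :: 'a)\<in>B. (lborel :: real measure)"
    by (rule lborel_family.sigma_finite) fact
  interpret Q: pair_sigma_finite "\<Pi>\<^sub>M (c :: 'a)\<in>B. (lborel :: real measure)" "lborel :: real measure" ..
  have "(\<integral>\<^sup>+x. (\<integral>\<^sup>+s. h x s \<partial>lborel) \<partial>coord_lborel B)
     = (\<integral>\<^sup>+p. (\<integral>\<^sup>+s. h (\<Sum>c\<in>B. p c *\<^sub>R c) s \<partial>lborel) \<partial>(\<Pi>\<^sub>M c\<in>B. lborel))"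
    by (subst nn_integral_coord_lborel) auto
  also have "\<dots> = (\<integral>\<^sup>+s. (\<integral>\<^sup>+p. h (\<Sum>c\<in>B. p c *\<^sub>R c) s \<partial>(\<Pi>\<^sub>M c\<in>B. lborel)) \<partial>lborel)"
    by (rule Q.Fubini'[symmetric]) measurable
  also have "\<dots> = (\<integral>\<^sup>+s. (\<integral>\<^sup>+x. h x s \<partial>coord_lborel B) \<partial>lborel)"
    by (subst nn_integral_coord_lborel) auto
  finally show ?thesis .
qed

section \<open>Translations and shears\<close>

lemma nn_integral_real_translate:
  fixes f :: "real \<Rightarrow> ennreal"
  assumes "f \<in> borel_measurable borel"
  shows "(\<integral>\<^sup>+x. f (x + c) \<partial>lborel) = (\<integral>\<^sup>+x. f x \<partial>lborel)"
  using nn_integral_real_affine[OF assms, of 1 c] by (simp add: add.commute)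

text \<open>One coordinate at a time: the component of \<open>a\<close> along \<open>b\<close> is a
  translation on the real line, and the remainder \<open>a'\<close> lies in
  \<open>coord_space B\<close>, where the induction hypothesis applies.\<close>

lemma nn_integral_coord_lborel_translate:
  fixes f :: "'a::euclidean_space \<Rightarrow> ennreal"
  assumes "finite B" "B \<subseteq> Basis" "f \<in> borel_measurable borel" "a \<in> coord_space B"
  shows "(\<integral>\<^sup>+x. f (x + a) \<partial>coord_lborel B) = (\<integral>\<^sup>+x. f x \<partial>coord_lborel B)"
  using assms
proof (induction B arbitrary: f a rule: finite_induct)
  case empty
  then have "a = 0" by (auto simp: coord_space_def euclidean_all_zero_iff)
  then show ?case by simp
next
  case (insert b B)
  note [measurable] = insert.prems(2)
  have b: "b \<in> Basis" "B \<subseteq> Basis" using insert by auto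
  define a' where "a' = a - (a \<bullet> b) *\<^sub>R b"
  have a': "a' \<in> coord_space B" 
    unfolding a'_def by (rule coord_space_insert_remove) (use insert b in auto)
  have "(\<integral>\<^sup>+x. f (x + a) \<partial>coord_lborel (insert b B))
    = (\<integral>\<^sup>+x. (\<integral>\<^sup>+s. f (x + s *\<^sub>R b + a) \<partial>lborel) \<partial>coord_lborel B)"
    by (subst nn_integral_coord_lborel_insert) (use insert in auto)
  also have "\<dots> = (\<integral>\<^sup>+x. (\<integral>\<^sup>+s. f ((x + a') + (s + a \<bullet> b) *\<^sub>R b) \<partial>lborel) \<partial>coord_lborel B)"
    by (simp add: a'_def algebra_simps)
  also have "\<dots> = (\<integral>\<^sup>+x. (\<integral>\<^sup>+s. f ((x + a') + s *\<^sub>R b) \<partial>lborel) \<partial>coord_lborel B)"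
    by (subst nn_integral_real_translate[of "\<lambda>s. f (_ + s *\<^sub>R b)"]) auto
  also have "\<dots> = (\<integral>\<^sup>+x. (\<integral>\<^sup>+s. f (x + s *\<^sub>R b) \<partial>lborel) \<partial>coord_lborel B)"
    by (rule insert.IH[of "\<lambda>x. \<integral>\<^sup>+s. f (x + s *\<^sub>R b) \<partial>lborel"]) (use a' b in auto)
  also have "\<dots> = (\<integral>\<^sup>+x. f x \<partial>coord_lborel (insert b B))"
    by (subst nn_integral_coord_lborel_insert) (use insert in auto)
  finally show ?case .
qed

text \<open>As \<open>v \<bullet> b = 1\<close>, the vector \<open>v - b\<close> lies in
  \<open>coord_space B\<close>, so replacing lines in direction \<open>b\<close> by lines in
  direction \<open>v\<close> is a shear and preserves volume. Swapping the integrals fixes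
  \<open>s\<close> and turns the shear into the translation by \<open>z' + s *\<^sub>R v'\<close>
  inside \<open>coord_space B\<close>.\<close>

lemma nn_integral_coord_lborel_shear:
  fixes h :: "'a::euclidean_space \<Rightarrow> ennreal"
  assumes [measurable]: "h \<in> borel_measurable borel"
    and B: "finite B" "B \<subseteq> Basis" "b \<in> Basis" "b \<notin> B"
    and z: "z \<in> coord_space (insert b B)" and v: "v \<in> coord_space (insert b B)" "v \<bullet> b = 1"
  shows "(\<integral>\<^sup>+x. (\<integral>\<^sup>+s. h (z + x + s *\<^sub>R v) \<partial>lborel) \<partial>coord_lborel B)
    = (\<integral>\<^sup>+x. h x \<partial>coord_lborel (insert b B))"
proof -
  define z' where "z' = z - (z \<bullet> b) *\<^sub>R b"
  define v' where "v' = v - b"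
  have *: "z' \<in> coord_space B" "v' \<in> coord_space B"
    using coord_space_insert_remove[OF B(3) z] coord_space_insert_remove[OF B(3) v(1)] v(2)
    by (auto simp: z'_def v'_def)
  have "(\<integral>\<^sup>+x. (\<integral>\<^sup>+s. h (z + x + s *\<^sub>R v) \<partial>lborel) \<partial>coord_lborel B)
    = (\<integral>\<^sup>+s. (\<integral>\<^sup>+x. h (x + (z' + s *\<^sub>R v') + (s + z \<bullet> b) *\<^sub>R b) \<partial>coord_lborel B) \<partial>lborel)"
    by (subst nn_integral_coord_lborel_swap) (auto simp: B z'_def v'_def algebra_simps)
  also have "\<dots> = (\<integral>\<^sup>+s. (\<integral>\<^sup>+x. h (x + (s + z \<bullet> b) *\<^sub>R b) \<partial>coord_lborel B) \<partial>lborel)"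
    by (intro nn_integral_cong nn_integral_coord_lborel_translate[of B "\<lambda>x. h (x + (_ + z \<bullet> b) *\<^sub>R b)"])
      (use B * in \<open>auto intro!: coord_space_add coord_space_scaleR\<close>)
  also have "\<dots> = (\<integral>\<^sup>+x. (\<integral>\<^sup>+s. h (x + (s + z \<bullet> b) *\<^sub>R b) \<partial>lborel) \<partial>coord_lborel B)"
    by (rule nn_integral_coord_lborel_swap[symmetric]) (use B in auto)
  also have "\<dots> = (\<integral>\<^sup>+x. (\<integral>\<^sup>+s. h (x + s *\<^sub>R b) \<partial>lborel) \<partial>coord_lborel B)"
    by (subst nn_integral_real_translate[of "\<lambda>s. h (_ + s *\<^sub>R b)"]) auto
  also have "\<dots> = (\<integral>\<^sup>+x. h x \<partial>coord_lborel (insert b B))"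
    by (rule nn_integral_coord_lborel_insert[symmetric]) (use B in auto)
  finally show ?thesis .
qed

subsection \<open>Splitting at a median hyperplane\<close>

text \<open>Integrate \<open>1 + u \<le> exp u\<close>. The negative part of \<open>u\<close> is
  moved to the right-hand side, so that only non-negative functions are integrated and
  \<open>M\<close> may have infinite mass.\<close>

lemma emeasure_le_nn_integral_exp:
  assumes u: "integrable M u" and 0: "(\<integral>x. u x \<partial>M) = 0"
  shows "emeasure M (space M) \<le> (\<integral>\<^sup>+x. ennreal (exp (u x)) \<partial>M)"
proof -
  have [measurable]: "u \<in> borel_measurable M" using u by auto
  let ?P = "\<integral>\<^sup>+x. ennreal (u x) \<partial>M" and ?N = "\<integral>\<^sup>+x. ennreal (- u x) \<partial>M"
  have fin: "?P \<noteq> top" "?N \<noteq> top" using u by (auto simp: real_integrable_def)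
  have "enn2real ?P = enn2real ?N" using 0 u by (simp add: real_lebesgue_integral_def)
  then have eq: "?P = ?N" using fin by (metis ennreal_enn2real top.not_eq_extremum)
  have "ennreal (u x) + 1 \<le> ennreal (- u x) + ennreal (exp (u x))" for x
  proof (cases "u x \<ge> 0")
    case True
    have "ennreal (u x) + 1 = ennreal (u x + 1)" using True by simp
    also have "\<dots> \<le> ennreal (exp (u x))"
      using exp_ge_add_one_self[of "u x"] by (intro ennreal_leI) linarith
    finally show ?thesis using True by (simp add: ennreal_neg)
  next
    case False
    have "1 \<le> ennreal (- u x + exp (u x))"
      unfolding ennreal_1[symmetric]
      using exp_ge_add_one_self[of "u x"] by (intro ennreal_leI) linarith
    also have "\<dots> = ennreal (- u x) + ennreal (exp (u x))"
      using False by (intro ennreal_plus) auto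
    finally show ?thesis using False by (simp add: ennreal_neg)
  qed
  then have "(\<integral>\<^sup>+x. ennreal (u x) + 1 \<partial>M) \<le> (\<integral>\<^sup>+x. ennreal (- u x) + ennreal (exp (u x)) \<partial>M)"
    by (intro nn_integral_mono)
  then have "?P + emeasure M (space M) \<le> ?N + (\<integral>\<^sup>+x. ennreal (exp (u x)) \<partial>M)"
    by (simp add: nn_integral_add)
  then show ?thesis using eq fin by (simp add: ennreal_add_left_cancel_le)
qed

text \<open>The distribution function of \<open>x \<bullet> b\<close> is continuous because the
  hyperplanes are null, so it takes the value of half the total mass. Nullness also allows the
  hyperplane to be dropped from the lower half.\<close>

lemma exists_median:
  fixes N :: "'a::euclidean_space measure"
  assumes N: "finite_measure N" "sets N = sets borel"
    and null: "\<And>c. emeasure N {x. x \<bullet> b = c} = 0"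
    and pos: "emeasure N UNIV > 0"
  obtains c where "emeasure N {x. x \<bullet> b < c} = emeasure N {x. x \<bullet> b > c}"
    "emeasure N UNIV = 2 * emeasure N {x. x \<bullet> b > c}"
proof -
  interpret finite_measure N by fact
  note [measurable_cong] = N(2)
  have sp: "space N = UNIV" using sets_eq_imp_space_eq[OF N(2)] by simp
  have m[measurable]: "(\<lambda>x. x \<bullet> b) \<in> measurable N borel" by measurable
  let ?D = "distr N borel (\<lambda>x. x \<bullet> b)"
  interpret D: finite_measure ?D by (rule finite_measure_distr) fact
  interpret D: finite_borel_measure ?D by unfold_locales simp
  have meas: "measure ?D A = measure N {x. x \<bullet> b \<in> A}" if "A \<in> sets borel" for A
    using that by (subst measure_distr) (auto simp: sp vimage_def)
  have null': "measure N {x. x \<bullet> b = c} = 0" for c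
    using null[of c] by (simp add: measure_def)
  have cont: "isCont (cdf ?D) x" for x
    using null' by (simp add: D.isCont_cdf meas)
  let ?m = "measure N UNIV"
  have "?m > 0" using pos by (simp add: emeasure_eq_measure)
  have D: "measure ?D (space ?D) = ?m" by (subst meas[symmetric, of UNIV, simplified]) simp_all
  have "\<forall>\<^sub>F x in at_bot. cdf ?D x < ?m / 2"
    using D.cdf_lim_at_bot \<open>?m > 0\<close> by (intro order_tendstoD) auto
  then obtain c1 where c1: "cdf ?D c1 < ?m / 2"
    by (auto simp: eventually_at_bot_linorder)
  have "\<forall>\<^sub>F x in at_top. cdf ?D x > ?m / 2"
    using D.cdf_lim_at_top \<open>?m > 0\<close> unfolding D by (intro order_tendstoD) auto
  then obtain c2 where c2: "cdf ?D c2 > ?m / 2"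
    by (auto simp: eventually_at_top_linorder)
  have "c1 \<le> c2"
    using c1 c2 D.cdf_nondecreasing[of c2 c1] by (cases "c1 \<le> c2") auto
  then obtain c where c: "cdf ?D c = ?m / 2"
    using IVT[of "cdf ?D" c1 "?m / 2" c2] c1 c2 cont by auto
  then have le: "measure N {x. x \<bullet> b \<le> c} = ?m / 2"
    by (simp add: cdf_def meas)
  have "{x. x \<bullet> b \<le> c} = {x. x \<bullet> b < c} \<union> {x. x \<bullet> b = c}" by auto
  then have "measure N {x. x \<bullet> b \<le> c} = measure N {x. x \<bullet> b < c} + measure N {x. x \<bullet> b = c}"
    by (simp only:) (rule finite_measure_Union, auto)
  then have lt: "measure N {x. x \<bullet> b < c} = ?m / 2"
    using le null' by simp
  have "measure N ({x. x \<bullet> b \<le> c} \<union> {x. x \<bullet> b > c})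
      = measure N {x. x \<bullet> b \<le> c} + measure N {x. x \<bullet> b > c}"
    by (rule finite_measure_Union) auto
  also have "{x. x \<bullet> b \<le> c} \<union> {x. x \<bullet> b > c} = UNIV" by auto
  finally have gt: "measure N {x. x \<bullet> b > c} = ?m / 2"
    using le by simp
  show ?thesis
  proof (rule that)
    show "emeasure N {x. x \<bullet> b < c} = emeasure N {x. x \<bullet> b > c}"
      using lt gt by (simp add: emeasure_eq_measure)
    have "ennreal ?m = 2 * ennreal (?m / 2)"
      by (subst ennreal_numeral[symmetric], subst ennreal_mult[symmetric]) auto
    then show "emeasure N UNIV = 2 * emeasure N {x. x \<bullet> b > c}"
      unfolding emeasure_eq_measure gt .
  qed
qed

text \<open>The vector paired with \<open>p\<close> is the projection of \<open>x - z\<close> along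
  \<open>v\<close> onto the hyperplane through the origin orthogonal to \<open>b\<close>. With
  \<open>z\<close> and \<open>v\<close> taken from the line through the two barycenters, both
  barycenters project to \<open>0\<close>, so the exponent has mean \<open>0\<close> under
  \<open>N1\<close> and under \<open>N2\<close>, and convexity of \<open>exp\<close> gives both
  inequalities.\<close>

lemma barycenter_line:
  fixes N1 N2 :: "'a::euclidean_space measure"
  assumes N1: "finite_measure N1" "sets N1 = sets borel"
    and N2: "finite_measure N2" "sets N2 = sets borel"
    and bd: "AE x in N1. norm x \<le> R" "AE x in N2. norm x \<le> R"
    and sp: "AE x in N1. x \<in> coord_space B" "AE x in N2. x \<in> coord_space B"
    and mass: "emeasure N1 UNIV = emeasure N2 UNIV" "emeasure N1 UNIV > 0"
    and side: "AE x in N1. x \<bullet> b > c" "AE x in N2. x \<bullet> b < c"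
  obtains z v where "z \<in> coord_space B" "v \<in> coord_space B" "z \<bullet> b = c" "v \<bullet> b = 1"
    "\<And>p. emeasure N1 UNIV \<le> (\<integral>\<^sup>+x. ennreal (exp (p \<bullet> (x - z - (x \<bullet> b - c) *\<^sub>R v))) \<partial>N1)"
    "\<And>p. emeasure N2 UNIV \<le> (\<integral>\<^sup>+x. ennreal (exp (p \<bullet> (x - z - (x \<bullet> b - c) *\<^sub>R v))) \<partial>N2)"
proof -
  interpret N1: finite_measure N1 by fact
  interpret N2: finite_measure N2 by fact
  note [measurable_cong] = N1(2) N2(2)
  have UN: "space N1 = UNIV" "space N2 = UNIV"
    using sets_eq_imp_space_eq[OF N1(2)] sets_eq_imp_space_eq[OF N2(2)] by auto
  have i1: "integrable N1 (\<lambda>x. x)" by (rule N1.integrable_const_bound[OF bd(1)]) measurable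
  have i2: "integrable N2 (\<lambda>x. x)" by (rule N2.integrable_const_bound[OF bd(2)]) measurable
  define a1 where "a1 = (\<integral>x. x \<partial>N1)"
  define a2 where "a2 = (\<integral>x. x \<partial>N2)"
  define m where "m = measure N1 UNIV"
  have m: "m > 0" "measure N2 UNIV = m"
    using mass by (auto simp: m_def N1.emeasure_eq_measure N2.emeasure_eq_measure)
  \<comment> \<open>\<open>t1 / m\<close> and \<open>t2 / m\<close> are the values of
    \<open>x \<bullet> b - c\<close> at the barycenters \<open>a1 / m\<close> and
    \<open>a2 / m\<close>.\<close>
  define t1 where "t1 = a1 \<bullet> b - c * m"
  define t2 where "t2 = a2 \<bullet> b - c * m"
  have t1: "(\<integral>x. x \<bullet> b - c \<partial>N1) = t1" "integrable N1 (\<lambda>x. x \<bullet> b - c)"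
    using i1 by (auto simp: t1_def a1_def m_def UN mult.commute)
  have t2: "(\<integral>x. c - x \<bullet> b \<partial>N2) = - t2" "integrable N2 (\<lambda>x. c - x \<bullet> b)"
    using i2 m by (auto simp: t2_def a2_def UN mult.commute)
  have "t1 \<ge> 0" unfolding t1(1)[symmetric]
    using side(1) by (intro integral_nonneg_AE) auto
  moreover have "t1 \<noteq> 0"
  proof
    assume "t1 = 0"
    then have "AE x in N1. x \<bullet> b - c = 0"
      using integral_nonneg_eq_0_iff_AE[OF t1(2)] t1(1) AE_mp[OF side(1) AE_I2, of "\<lambda>x. 0 \<le> x \<bullet> b - c"]
      by auto
    then have "AE x in N1. False" using side(1) by eventually_elim auto
    then have "emeasure N1 UNIV = 0" by (simp add: AE_iff_measurable[of UNIV] UN)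
    then show False using mass by simp
  qed
  moreover have "- t2 \<ge> 0" unfolding t2(1)[symmetric]
    using side(2) by (intro integral_nonneg_AE) auto
  ultimately have d: "t1 - t2 > 0" by simp
  \<comment> \<open>Because the masses are equal, \<open>(a1 - a2) \<bullet> b = t1 - t2\<close>, so
    this scaling gives \<open>v \<bullet> b = 1\<close>. The point \<open>z\<close> is the
    barycenter \<open>a1 / m\<close> moved along \<open>v\<close> into the hyperplane.\<close>
  define v where "v = (1 / (t1 - t2)) *\<^sub>R (a1 - a2)"
  define z where "z = (1 / m) *\<^sub>R (a1 - t1 *\<^sub>R v)"
  have in_sp: "a1 \<in> coord_space B" "a2 \<in> coord_space B"
  proof -
    show "a1 \<in> coord_space B"
      unfolding coord_space_def a1_def
    proof (clarify)
      fix e assume "e \<in> Basis" "e \<notin> B"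
      then have "AE x in N1. x \<bullet> e = 0" using sp(1) by (auto simp: coord_space_def)
      then have "(\<integral>x. x \<bullet> e \<partial>N1) = 0" by (rule integral_eq_zero_AE)
      then show "(\<integral>x. x \<partial>N1) \<bullet> e = 0" using i1 by simp
    qed
    show "a2 \<in> coord_space B"
      unfolding coord_space_def a2_def
    proof (clarify)
      fix e assume "e \<in> Basis" "e \<notin> B"
      then have "AE x in N2. x \<bullet> e = 0" using sp(2) by (auto simp: coord_space_def)
      then have "(\<integral>x. x \<bullet> e \<partial>N2) = 0" by (rule integral_eq_zero_AE)
      then show "(\<integral>x. x \<partial>N2) \<bullet> e = 0" using i2 by simp
    qed
  qed
  have vs: "v \<in> coord_space B"
    using in_sp by (auto simp: v_def coord_space_def inner_diff_left)
  have zs: "z \<in> coord_space B"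
    using in_sp vs by (auto simp: z_def coord_space_def inner_diff_left)
  have vb: "v \<bullet> b = 1" using d by (simp add: v_def inner_diff_left t1_def t2_def)
  have zb: "z \<bullet> b = c"
    using m vb by (simp add: z_def inner_diff_left t1_def)
  have e1: "a1 = m *\<^sub>R z + t1 *\<^sub>R v" using m by (simp add: z_def)
  have "a1 - a2 = (t1 - t2) *\<^sub>R v" using d by (simp add: v_def)
  then have e2: "a2 = m *\<^sub>R z + t2 *\<^sub>R v" using e1 by (simp add: algebra_simps)
  show ?thesis
  proof (rule that[OF zs vs zb vb])
    fix p
    have 0: "(\<integral>x. p \<bullet> (x - z - (x \<bullet> b - c) *\<^sub>R v) \<partial>N1) = p \<bullet> (a1 - m *\<^sub>R z - t1 *\<^sub>R v)"
      using i1 by (simp add: inner_diff_right inner_add_right a1_def[symmetric] m_def[symmetric] t1_def UN algebra_simps)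
    show "emeasure N1 UNIV \<le> (\<integral>\<^sup>+x. ennreal (exp (p \<bullet> (x - z - (x \<bullet> b - c) *\<^sub>R v))) \<partial>N1)"
      unfolding UN(1)[symmetric] by (rule emeasure_le_nn_integral_exp) (use i1 0 e1 in auto)
    have 0: "(\<integral>x. p \<bullet> (x - z - (x \<bullet> b - c) *\<^sub>R v) \<partial>N2) = p \<bullet> (a2 - m *\<^sub>R z - t2 *\<^sub>R v)"
      using i2 m by (simp add: inner_diff_right inner_add_right a2_def[symmetric] t2_def UN algebra_simps)
    show "emeasure N2 UNIV \<le> (\<integral>\<^sup>+x. ennreal (exp (p \<bullet> (x - z - (x \<bullet> b - c) *\<^sub>R v))) \<partial>N2)"
      unfolding UN(2)[symmetric] by (rule emeasure_le_nn_integral_exp) (use i2 0 e2 in auto)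
  qed
qed

subsection \<open>Induction on the dimension\<close>

text \<open>
  The condition on \<open>g\<close> replaces its barycenter being at the origin. The constant \<open>C\<close> absorbs
  the factor that is lost with each coordinate.
\<close>

definition functional_Santalo :: "'a::euclidean_space set \<Rightarrow> bool" where
  "functional_Santalo B \<longleftrightarrow> (\<forall>f g C. f \<in> borel_measurable borel \<longrightarrow> g \<in> borel_measurable borel \<longrightarrow> 0 \<le> C \<longrightarrow>
     (\<forall>x\<in>coord_space B. \<forall>y\<in>coord_space B. f x * g y \<le> ennreal (C * exp (- (x \<bullet> y)))) \<longrightarrow>
     (\<forall>p. (\<integral>\<^sup>+y. g y \<partial>coord_lborel B) \<le> (\<integral>\<^sup>+y. ennreal (exp (p \<bullet> y)) * g y \<partial>coord_lborel B)) \<longrightarrow>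
     (\<integral>\<^sup>+x. f x \<partial>coord_lborel B) * (\<integral>\<^sup>+y. g y \<partial>coord_lborel B) \<le> ennreal (C * (2 * pi) ^ card B))"

lemma functional_SantaloD:
  assumes "functional_Santalo B" "f \<in> borel_measurable borel" "g \<in> borel_measurable borel" "0 \<le> C"
    and "\<And>x y. x \<in> coord_space B \<Longrightarrow> y \<in> coord_space B \<Longrightarrow> f x * g y \<le> ennreal (C * exp (- (x \<bullet> y)))"
    and "\<And>p. (\<integral>\<^sup>+y. g y \<partial>coord_lborel B) \<le> (\<integral>\<^sup>+y. ennreal (exp (p \<bullet> y)) * g y \<partial>coord_lborel B)"
  shows "(\<integral>\<^sup>+x. f x \<partial>coord_lborel B) * (\<integral>\<^sup>+y. g y \<partial>coord_lborel B) \<le> ennreal (C * (2 * pi) ^ card B)"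
  using assms unfolding functional_Santalo_def by blast

text \<open>The sign \<open>\<sigma>\<close> selects the side of the hyperplane. The shift by
  \<open>- (y \<bullet> v)\<close> makes the half-lines for \<open>g\<close> start on the hyperplane
  orthogonal to \<open>v\<close>; the cross terms then cancel and the inner product of the two
  moving points is \<open>x \<bullet> y + s * t\<close>. Duality on the half-line bounds
  \<open>F x * G y\<close> by \<open>C * (pi / 2) * exp (- (x \<bullet> y))\<close>, and the
  induction hypothesis finishes.\<close>

lemma functional_Santalo_half_space:
  fixes f g :: "'a::euclidean_space \<Rightarrow> ennreal"
  assumes IH: "functional_Santalo B"
    and B: "finite B" "B \<subseteq> Basis" "b \<in> Basis" "b \<notin> B"
    and [measurable]: "f \<in> borel_measurable borel" "g \<in> borel_measurable borel"
    and C: "0 \<le> C" and \<sigma>: "\<sigma> = 1 \<or> \<sigma> = - 1"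
    and z: "z \<in> coord_space (insert b B)" "z \<bullet> b = c"
    and v: "v \<in> coord_space (insert b B)" "v \<bullet> b = 1"
    and dual: "\<And>x y. x \<in> coord_space (insert b B) \<Longrightarrow> y \<in> coord_space (insert b B) \<Longrightarrow>
        f (z + x) * g y \<le> ennreal (C * exp (- (x \<bullet> y)))"
    and H_def: "H = (\<lambda>y. f y * indicator {y. 0 < \<sigma> * (y \<bullet> b - c)} y)"
    and bary: "\<And>p. (\<integral>\<^sup>+x. H x \<partial>coord_lborel (insert b B))
        \<le> (\<integral>\<^sup>+x. ennreal (exp (p \<bullet> (x - z - (x \<bullet> b - c) *\<^sub>R v))) * H x \<partial>coord_lborel (insert b B))"
  shows "(\<integral>\<^sup>+x. H x \<partial>coord_lborel (insert b B)) *
      (\<integral>\<^sup>+y. (\<integral>\<^sup>+t. g (y + (\<sigma> * t - y \<bullet> v) *\<^sub>R b) * indicator {0<..} t \<partial>lborel) \<partial>coord_lborel B)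
    \<le> ennreal (C * (pi / 2) * (2 * pi) ^ card B)"
proof -
  have [measurable]: "H \<in> borel_measurable borel" unfolding H_def by measurable
  \<comment> \<open>On \<open>coord_space B\<close> the indicator hidden in \<open>H\<close> restricts \<open>s\<close> to a half-line.\<close>
  define F where "F x = (\<integral>\<^sup>+s. H (z + x + s *\<^sub>R v) \<partial>lborel)" for x
  define G where "G y = (\<integral>\<^sup>+t. g (y + (\<sigma> * t - y \<bullet> v) *\<^sub>R b) * indicator {0<..} t \<partial>lborel)" for y
  have [measurable]: "F \<in> borel_measurable borel" "G \<in> borel_measurable borel"
    unfolding F_def G_def by measurable
  have bE: "b \<in> coord_space (insert b B)" using B by (auto intro: coord_space_basis_vector)
  have sub: "coord_space B \<subseteq> coord_space (insert b B)" by (rule coord_space_mono) auto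
  have bb: "b \<bullet> b = 1" using B by simp
  have \<sigma>2: "\<sigma> * \<sigma> = 1" "\<bar>\<sigma>\<bar> = 1" "\<sigma> \<noteq> 0" using \<sigma> by auto
  have F_eq: "F x = (\<integral>\<^sup>+s. f (z + x + (\<sigma> * s) *\<^sub>R v) * indicator {0<..} s \<partial>lborel)"
    if x: "x \<in> coord_space B" for x
  proof -
    have xb: "x \<bullet> b = 0" using x B by (auto intro: coord_space_orthogonal)
    \<comment> \<open>Substituting \<open>\<sigma> * s\<close> for \<open>s\<close> makes the
      half-line positive for either sign.\<close>
    have "F x = (\<integral>\<^sup>+s. H (z + x + (\<sigma> * s) *\<^sub>R v) \<partial>lborel)"
      unfolding F_def using nn_integral_real_affine[of "\<lambda>s. H (z + x + s *\<^sub>R v)" \<sigma> 0] \<sigma>2 by simp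
    also have "\<dots> = (\<integral>\<^sup>+s. f (z + x + (\<sigma> * s) *\<^sub>R v) * indicator {0<..} s \<partial>lborel)"
    proof (intro nn_integral_cong)
      fix s
      have "\<sigma> * ((z + x + (\<sigma> * s) *\<^sub>R v) \<bullet> b - c) = \<sigma> * \<sigma> * s"
        using z v xb by (simp add: inner_add_left)
      then show "H (z + x + (\<sigma> * s) *\<^sub>R v) = f (z + x + (\<sigma> * s) *\<^sub>R v) * indicator {0<..} s"
        unfolding H_def using \<sigma>2 by (simp add: indicator_def)
    qed
    finally show ?thesis .
  qed
  have int_F: "(\<integral>\<^sup>+x. ennreal (exp (p \<bullet> x)) * F x \<partial>coord_lborel B)
    = (\<integral>\<^sup>+x. ennreal (exp (p \<bullet> (x - z - (x \<bullet> b - c) *\<^sub>R v))) * H x \<partial>coord_lborel (insert b B))" for p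
  proof -
    let ?K = "\<lambda>y. ennreal (exp (p \<bullet> (y - z - (y \<bullet> b - c) *\<^sub>R v))) * H y"
    have "(\<integral>\<^sup>+x. ennreal (exp (p \<bullet> x)) * F x \<partial>coord_lborel B)
      = (\<integral>\<^sup>+x. (\<integral>\<^sup>+s. ?K (z + x + s *\<^sub>R v) \<partial>lborel) \<partial>coord_lborel B)"
    proof (rule nn_integral_cong_AE)
      show "AE x in coord_lborel B. ennreal (exp (p \<bullet> x)) * F x = (\<integral>\<^sup>+s. ?K (z + x + s *\<^sub>R v) \<partial>lborel)"
        using AE_coord_lborel[OF B(2)]
      proof eventually_elim
        case (elim x)
        then have xb: "x \<bullet> b = 0" using B by (auto intro: coord_space_orthogonal)
        \<comment> \<open>The projection is constant along lines in direction \<open>v\<close>, so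
          the exponential factor can be taken out of the inner integral.\<close>
        have "z + x + s *\<^sub>R v - z - ((z + x + s *\<^sub>R v) \<bullet> b - c) *\<^sub>R v = x" for s
          using z v xb by (simp add: inner_add_left)
        then show ?case unfolding F_def by (simp only:) (rule nn_integral_cmult[symmetric], measurable)
      qed
    qed
    also have "\<dots> = (\<integral>\<^sup>+x. ?K x \<partial>coord_lborel (insert b B))"
      by (rule nn_integral_coord_lborel_shear) (use B z v in auto)
    finally show ?thesis .
  qed
  have int_F0: "(\<integral>\<^sup>+x. F x \<partial>coord_lborel B) = (\<integral>\<^sup>+x. H x \<partial>coord_lborel (insert b B))"
    using int_F[of 0] by simp
  have "(\<integral>\<^sup>+y. G y \<partial>coord_lborel B) * (\<integral>\<^sup>+x. F x \<partial>coord_lborel B)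
    \<le> ennreal (C * (pi / 2) * (2 * pi) ^ card B)"
  \<comment> \<open>The roles are exchanged: \<open>F\<close>, the integrated half of
    \<open>f\<close>, takes the second place because its barycenter condition is the one
    available.\<close>
  proof (rule functional_SantaloD[OF IH])
    fix y x assume y: "y \<in> coord_space B" and x: "x \<in> coord_space B"
    have xb: "x \<bullet> b = 0" using x B by (auto intro: coord_space_orthogonal)
    have "F x * G y \<le> ennreal ((C * exp (- (x \<bullet> y))) * (pi / 2))"
      unfolding F_eq[OF x] unfolding G_def
    proof (rule nn_integral_half_line_duality)
      fix s t :: real assume st: "s > 0" "t > 0"
      have "f (z + (x + (\<sigma> * s) *\<^sub>R v)) * g (y + (\<sigma> * t - y \<bullet> v) *\<^sub>R b)
        \<le> ennreal (C * exp (- ((x + (\<sigma> * s) *\<^sub>R v) \<bullet> (y + (\<sigma> * t - y \<bullet> v) *\<^sub>R b))))"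
        using x y sub v bE by (intro dual coord_space_add coord_space_scaleR) auto
      also have "(x + (\<sigma> * s) *\<^sub>R v) \<bullet> (y + (\<sigma> * t - y \<bullet> v) *\<^sub>R b)
        = x \<bullet> y + (\<sigma> * s) * (v \<bullet> y) + (\<sigma> * s) * (\<sigma> * t - y \<bullet> v)"
        using xb v(2) by (simp add: inner_add_left inner_add_right)
      also have "\<dots> = x \<bullet> y + (\<sigma> * \<sigma>) * (s * t)"
        by (simp add: inner_commute algebra_simps)
      also have "C * exp (- (x \<bullet> y + (\<sigma> * \<sigma>) * (s * t))) = C * exp (- (x \<bullet> y)) * exp (- (s * t))"
        by (simp add: \<sigma>2 exp_add[symmetric])
      finally show "f (z + x + (\<sigma> * s) *\<^sub>R v) * g (y + (\<sigma> * t - y \<bullet> v) *\<^sub>R b)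
        \<le> ennreal (C * exp (- (x \<bullet> y)) * exp (- (s * t)))"
        by (simp add: add.assoc)
    qed (use C in auto)
    then show "G y * F x \<le> ennreal (C * (pi / 2) * exp (- (y \<bullet> x)))"
      by (simp add: mult_ac inner_commute)
  next
    fix p
    show "(\<integral>\<^sup>+x. F x \<partial>coord_lborel B) \<le> (\<integral>\<^sup>+x. ennreal (exp (p \<bullet> x)) * F x \<partial>coord_lborel B)"
      unfolding int_F int_F0 by (rule bary)
  qed (use C in auto)
  then show ?thesis unfolding int_F0 by (simp add: G_def mult.commute)
qed

lemma functional_Santalo_empty: "functional_Santalo {}"
  unfolding functional_Santalo_def
proof (intro allI impI)
  fix f g :: "'a \<Rightarrow> ennreal" and C :: real
  assume [measurable]: "f \<in> borel_measurable borel" "g \<in> borel_measurable borel"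
    and le: "\<forall>x\<in>coord_space {}. \<forall>y\<in>coord_space {}. f x * g y \<le> ennreal (C * exp (- (x \<bullet> y)))"
  have "0 \<in> coord_space ({} :: 'a set)" by (simp add: coord_space_def)
  with le have "f 0 * g 0 \<le> ennreal (C * exp (- (0 \<bullet> (0 :: 'a))))" by blast
  then show "(\<integral>\<^sup>+x. f x \<partial>coord_lborel {}) * (\<integral>\<^sup>+y. g y \<partial>coord_lborel {}) \<le> ennreal (C * (2 * pi) ^ card ({} :: 'a set))"
    by (simp add: nn_integral_coord_lborel_empty)
qed

section \<open>Balls, hyperplanes and lines under the coordinate measure\<close>

lemma emeasure_coord_lborel_cball:
  assumes "finite B" "B \<subseteq> Basis"
  shows "emeasure (coord_lborel B) (cball (0 :: 'a::euclidean_space) R) < top"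
proof -
  let ?P = "\<Pi>\<^sub>M (c :: 'a)\<in>B. (lborel :: real measure)"
  have "emeasure (coord_lborel B) (cball 0 R) = emeasure ?P ((\<lambda>p. \<Sum>b\<in>B. p b *\<^sub>R b) -` cball 0 R \<inter> space ?P)"
    unfolding coord_lborel_def by (rule emeasure_distr) auto
  also have "\<dots> \<le> emeasure ?P (\<Pi>\<^sub>E b\<in>B. {-R..R})"
  proof (rule emeasure_mono)
    show "(\<lambda>p. \<Sum>b\<in>B. p b *\<^sub>R b) -` cball 0 R \<inter> space ?P \<subseteq> (\<Pi>\<^sub>E b\<in>B. {-R..R})"
    proof
      fix p assume p: "p \<in> (\<lambda>p. \<Sum>b\<in>B. p b *\<^sub>R b) -` cball 0 R \<inter> space ?P"
      have "p c \<in> {-R..R}" if c: "c \<in> B" for c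
      proof -
        have "(\<Sum>b\<in>B. p b *\<^sub>R b) \<bullet> c = (\<Sum>b\<in>B. if b = c then p b else 0)"
          unfolding inner_sum_left using assms c by (intro sum.cong) (auto simp: inner_Basis subset_iff)
        also have "\<dots> = p c" using assms c by simp
        finally have "\<bar>p c\<bar> \<le> norm (\<Sum>b\<in>B. p b *\<^sub>R b)"
          using Basis_le_norm[of c "\<Sum>b\<in>B. p b *\<^sub>R b"] assms c by auto
        then show ?thesis using p by auto
      qed
      then show "p \<in> (\<Pi>\<^sub>E b\<in>B. {-R..R})" using p by (auto simp: space_PiM PiE_def)
    qed
    show "(\<Pi>\<^sub>E b\<in>B. {-R..R}) \<in> sets ?P" using assms by (intro sets_PiM_I_finite) auto
  qed
  also have "\<dots> = (\<Prod>b\<in>B. emeasure lborel {-R..R})"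
    using assms by (intro lborel_family.emeasure_PiM) auto
  also have "\<dots> < top"
    by (simp add: emeasure_lborel_Icc_eq power_less_top_ennreal)
  finally show ?thesis .
qed

text \<open>Each line in direction \<open>b\<close> meets the hyperplane in a single point. This is
  what makes a median hyperplane available.\<close>

lemma coord_lborel_hyperplane_null:
  fixes f :: "'a::euclidean_space \<Rightarrow> ennreal"
  assumes [measurable]: "f \<in> borel_measurable borel" and B: "finite B" "b \<in> Basis" "b \<notin> B"
  shows "emeasure (density (coord_lborel (insert b B)) f) {x. x \<bullet> b = c} = 0"
proof -
  have "emeasure (density (coord_lborel (insert b B)) f) {x. x \<bullet> b = c}
    = (\<integral>\<^sup>+x. f x * indicator {x. x \<bullet> b = c} x \<partial>coord_lborel (insert b B))"
    by (rule emeasure_density) auto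
  also have "\<dots> = (\<integral>\<^sup>+x. (\<integral>\<^sup>+s. f (x + s *\<^sub>R b) * indicator {x. x \<bullet> b = c} (x + s *\<^sub>R b) \<partial>lborel) \<partial>coord_lborel B)"
    by (rule nn_integral_coord_lborel_insert) (use B in auto)
  also have "\<dots> = (\<integral>\<^sup>+x. (\<integral>\<^sup>+(s::real). 0 \<partial>lborel) \<partial>coord_lborel B)"
  proof (rule nn_integral_cong, rule nn_integral_cong_AE)
    fix x
    show "AE s in lborel. f (x + s *\<^sub>R b) * indicator {x. x \<bullet> b = c} (x + s *\<^sub>R b) = 0"
      using AE_lborel_singleton[of "c - x \<bullet> b"]
      by eventually_elim (use B in \<open>auto simp: inner_add_left split: split_indicator\<close>)
  qed
  finally show ?thesis by simp
qed

text \<open>On each line in direction \<open>b\<close> the two half-lines miss only their common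
  starting point. That point depends on \<open>y \<bullet> v\<close>, but a shift along the line
  leaves the integral over the line unchanged.\<close>

lemma nn_integral_two_half_lines:
  fixes g :: "'a::euclidean_space \<Rightarrow> ennreal"
  assumes [measurable]: "g \<in> borel_measurable borel" and B: "finite B" "b \<notin> B"
  shows "(\<integral>\<^sup>+y. (\<integral>\<^sup>+t. g (y + (1 * t - y \<bullet> v) *\<^sub>R b) * indicator {0<..} t \<partial>lborel) \<partial>coord_lborel B)
    + (\<integral>\<^sup>+y. (\<integral>\<^sup>+t. g (y + (-1 * t - y \<bullet> v) *\<^sub>R b) * indicator {0<..} t \<partial>lborel) \<partial>coord_lborel B)
    = (\<integral>\<^sup>+y. g y \<partial>coord_lborel (insert b B))"
proof -
  have "(\<integral>\<^sup>+t. g (y + (1 * t - y \<bullet> v) *\<^sub>R b) * indicator {0<..} t \<partial>lborel)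
     + (\<integral>\<^sup>+t. g (y + (-1 * t - y \<bullet> v) *\<^sub>R b) * indicator {0<..} t \<partial>lborel)
     = (\<integral>\<^sup>+t. g (y + t *\<^sub>R b) \<partial>lborel)" for y
  proof -
    have "(\<integral>\<^sup>+t. g (y + (-1 * t - y \<bullet> v) *\<^sub>R b) * indicator {0<..} t \<partial>lborel)
      = (\<integral>\<^sup>+t. g (y + (t - y \<bullet> v) *\<^sub>R b) * indicator {..<0} t \<partial>lborel)"
      using nn_integral_real_affine[of "\<lambda>t. g (y + (t - y \<bullet> v) *\<^sub>R b) * indicator {..<0} t" "-1" 0]
      by (simp add: indicator_def)
    then have "(\<integral>\<^sup>+t. g (y + (1 * t - y \<bullet> v) *\<^sub>R b) * indicator {0<..} t \<partial>lborel)
     + (\<integral>\<^sup>+t. g (y + (-1 * t - y \<bullet> v) *\<^sub>R b) * indicator {0<..} t \<partial>lborel)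
     = (\<integral>\<^sup>+t. g (y + (t - y \<bullet> v) *\<^sub>R b) * indicator {0<..} t + g (y + (t - y \<bullet> v) *\<^sub>R b) * indicator {..<0} t \<partial>lborel)"
      by (simp add: nn_integral_add)
    also have "\<dots> = (\<integral>\<^sup>+t. g (y + (t - y \<bullet> v) *\<^sub>R b) \<partial>lborel)"
    proof (rule nn_integral_cong_AE)
      show "AE t in lborel. g (y + (t - y \<bullet> v) *\<^sub>R b) * indicator {0<..} t
          + g (y + (t - y \<bullet> v) *\<^sub>R b) * indicator {..<0} t = g (y + (t - y \<bullet> v) *\<^sub>R b)"
        using AE_lborel_singleton[of "0 :: real"]
        by eventually_elim (auto split: split_indicator)
    qed
    also have "\<dots> = (\<integral>\<^sup>+t. g (y + t *\<^sub>R b) \<partial>lborel)"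
      using nn_integral_real_translate[of "\<lambda>t. g (y + t *\<^sub>R b)" "- (y \<bullet> v)"] by simp
    finally show ?thesis .
  qed
  then show ?thesis
    by (simp add: nn_integral_add[symmetric] nn_integral_coord_lborel_insert[OF assms])
qed

section \<open>The induction step\<close>

lemma functional_Santalo_insert_bounded:
  fixes f g :: "'a::euclidean_space \<Rightarrow> ennreal"
  assumes IH: "functional_Santalo B"
    and B: "finite B" "B \<subseteq> Basis" "b \<in> Basis" "b \<notin> B"
    and [measurable]: "f \<in> borel_measurable borel" "g \<in> borel_measurable borel"
    and C: "0 \<le> C"
    and dual: "\<And>x y. x \<in> coord_space (insert b B) \<Longrightarrow> y \<in> coord_space (insert b B) \<Longrightarrow>
        f x * g y \<le> ennreal (C * exp (- (x \<bullet> y)))"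
    and bary: "\<And>p. (\<integral>\<^sup>+y. g y \<partial>coord_lborel (insert b B))
        \<le> (\<integral>\<^sup>+y. ennreal (exp (p \<bullet> y)) * g y \<partial>coord_lborel (insert b B))"
    and bd: "\<And>x. f x \<le> ennreal K" "\<And>x. norm x > R \<Longrightarrow> f x = 0"
  shows "(\<integral>\<^sup>+x. f x \<partial>coord_lborel (insert b B)) * (\<integral>\<^sup>+y. g y \<partial>coord_lborel (insert b B))
    \<le> ennreal (C * (2 * pi) ^ card (insert b B))"
proof (cases "(\<integral>\<^sup>+x. f x \<partial>coord_lborel (insert b B)) = 0")
  case True
  then show ?thesis by simp
next
  case False
  define M where "M = coord_lborel (insert b B)"
  have [measurable_cong, simp]: "sets M = sets borel" and [simp]: "space M = UNIV" by (auto simp: M_def)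
  have B': "finite (insert b B)" "insert b B \<subseteq> Basis" using B by auto
  \<comment> \<open>The bounds on \<open>f\<close> give this measure finite mass and bounded
    support, so that a median and first moments exist.\<close>
  define N where "N = density M f"
  have [measurable_cong, simp]: "sets N = sets borel" and [simp]: "space N = UNIV" by (auto simp: N_def)
  have N_UNIV: "emeasure N UNIV = (\<integral>\<^sup>+x. f x \<partial>M)"
    by (simp add: N_def emeasure_density)
  have "(\<integral>\<^sup>+x. f x \<partial>M) \<le> (\<integral>\<^sup>+x. ennreal K * indicator (cball 0 R) x \<partial>M)"
    using bd by (intro nn_integral_mono) (auto simp: indicator_def not_le)
  also have "\<dots> = ennreal K * emeasure M (cball 0 R)"
    by (rule nn_integral_cmult_indicator) simp
  also have "\<dots> < top"
    using emeasure_coord_lborel_cball[OF B'] by (simp add: M_def ennreal_mult_less_top)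
  finally have N_fin: "emeasure N UNIV < top" by (simp add: N_UNIV)
  interpret N: finite_measure N by (rule finite_measureI) (use N_fin in auto)
  have N_pos: "emeasure N UNIV > 0" using False by (simp add: N_UNIV M_def zero_less_iff_neq_zero)
  obtain c where c: "emeasure N {x. x \<bullet> b < c} = emeasure N {x. x \<bullet> b > c}"
    "emeasure N UNIV = 2 * emeasure N {x. x \<bullet> b > c}"
  proof (rule exists_median[OF N.finite_measure_axioms _ _ N_pos])
    show "emeasure N {x. x \<bullet> b = c} = 0" for c
      unfolding N_def M_def by (rule coord_lborel_hyperplane_null) (use B in auto)
  qed auto
  \<comment> \<open>The signs \<open>1\<close> and \<open>-1\<close> give the parts of
    \<open>f\<close> strictly above and strictly below the median hyperplane; each carries half of
    the mass.\<close>
  define H where "H \<sigma> = (\<lambda>x. f x * indicator {x. 0 < \<sigma> * (x \<bullet> b - c)} x)" for \<sigma> :: real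
  have [measurable]: "H \<sigma> \<in> borel_measurable borel" for \<sigma> unfolding H_def by measurable
  have H_int: "(\<integral>\<^sup>+x. H \<sigma> x \<partial>M) = emeasure N {x. 0 < \<sigma> * (x \<bullet> b - c)}" for \<sigma>
    unfolding N_def H_def by (subst emeasure_density) auto
  have H1: "(\<integral>\<^sup>+x. H 1 x \<partial>M) = emeasure N {x. x \<bullet> b > c}" by (simp add: H_int)
  have H2: "(\<integral>\<^sup>+x. H (-1) x \<partial>M) = emeasure N {x. x \<bullet> b > c}" by (simp add: H_int c(1))
  define L where "L \<sigma> = density M (H \<sigma>)" for \<sigma>
  have [measurable_cong, simp]: "sets (L \<sigma>) = sets borel" and [simp]: "space (L \<sigma>) = UNIV" for \<sigma>
    by (auto simp: L_def)
  have L_UNIV: "emeasure (L \<sigma>) UNIV = (\<integral>\<^sup>+x. H \<sigma> x \<partial>M)" for \<sigma>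
    by (simp add: L_def emeasure_density)
  have L_fin: "finite_measure (L \<sigma>)" for \<sigma>
  proof (rule finite_measureI)
    have "emeasure N {x. 0 < \<sigma> * (x \<bullet> b - c)} \<noteq> top" by simp
    then show "emeasure (L \<sigma>) (space (L \<sigma>)) \<noteq> \<infinity>" by (simp add: L_UNIV H_int)
  qed
  have L_bd: "AE x in L \<sigma>. norm x \<le> R" for \<sigma>
    unfolding L_def using bd(2) by (subst AE_density) (auto simp: H_def not_le[symmetric] intro!: AE_I2)
  have L_sp: "AE x in L \<sigma>. x \<in> coord_space (insert b B)" for \<sigma>
  proof -
    have "AE x in M. x \<in> coord_space (insert b B)" unfolding M_def by (rule AE_coord_lborel[OF B'(2)])
    then show ?thesis unfolding L_def by (subst AE_density) auto
  qed
  have L_side: "AE x in L \<sigma>. 0 < \<sigma> * (x \<bullet> b - c)" for \<sigma>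
    unfolding L_def by (subst AE_density) (auto simp: H_def split: split_indicator intro!: AE_I2)
  have L_exp: "(\<integral>\<^sup>+x. h x \<partial>L \<sigma>) = (\<integral>\<^sup>+x. h x * H \<sigma> x \<partial>M)" if [measurable]: "h \<in> borel_measurable borel" for h \<sigma>
    unfolding L_def by (subst nn_integral_density) (auto simp: mult.commute)
  obtain z v where zv: "z \<in> coord_space (insert b B)" "v \<in> coord_space (insert b B)" "z \<bullet> b = c" "v \<bullet> b = 1"
    and e1: "\<And>p. emeasure (L 1) UNIV \<le> (\<integral>\<^sup>+x. ennreal (exp (p \<bullet> (x - z - (x \<bullet> b - c) *\<^sub>R v))) \<partial>L 1)"
    and e2: "\<And>p. emeasure (L (-1)) UNIV \<le> (\<integral>\<^sup>+x. ennreal (exp (p \<bullet> (x - z - (x \<bullet> b - c) *\<^sub>R v))) \<partial>L (-1))"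
  proof (rule barycenter_line[OF L_fin[of 1] _ L_fin[of "-1"] _ L_bd[of 1] L_bd[of "-1"] L_sp[of 1] L_sp[of "-1"]])
    show "emeasure (L 1) UNIV = emeasure (L (-1)) UNIV" by (simp add: L_UNIV H1 H2)
    show "0 < emeasure (L 1) UNIV" using N_pos c(2) by (simp add: L_UNIV H1 zero_less_iff_neq_zero)
    show "AE x in L 1. c < x \<bullet> b" using L_side[of 1] by simp
    show "AE x in L (-1). x \<bullet> b < c" using L_side[of "-1"] by simp
  qed auto
  \<comment> \<open>In the duality the factor \<open>exp (z \<bullet> y)\<close> compensates for
    translating \<open>f\<close> by \<open>z\<close>, and by \<open>bary\<close> it does not
    decrease the integral of \<open>g\<close>.\<close>
  define k where "k y = ennreal (exp (z \<bullet> y)) * g y" for y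
  have [measurable]: "k \<in> borel_measurable borel" unfolding k_def by measurable
  have dual': "f (z + x) * k y \<le> ennreal (C * exp (- (x \<bullet> y)))"
    if "x \<in> coord_space (insert b B)" "y \<in> coord_space (insert b B)" for x y
  proof -
    have "f (z + x) * k y = ennreal (exp (z \<bullet> y)) * (f (z + x) * g y)"
      by (simp add: k_def mult_ac)
    also have "\<dots> \<le> ennreal (exp (z \<bullet> y)) * ennreal (C * exp (- ((z + x) \<bullet> y)))"
      using that zv by (intro mult_left_mono dual coord_space_add) auto
    also have "\<dots> = ennreal (C * exp (- (x \<bullet> y)))"
      using C by (simp add: ennreal_mult[symmetric] inner_add_left mult.left_commute exp_add[symmetric])
    finally show ?thesis .
  qed
  let ?Q = "ennreal (C * (pi / 2) * (2 * pi) ^ card B)"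
  let ?I = "\<lambda>\<sigma>. \<integral>\<^sup>+y. (\<integral>\<^sup>+t. k (y + (\<sigma> * t - y \<bullet> v) *\<^sub>R b) * indicator {0<..} t \<partial>lborel) \<partial>coord_lborel B"
  let ?m = "emeasure N {x. x \<bullet> b > c}"
  have "(\<integral>\<^sup>+x. H 1 x \<partial>M) * ?I 1 \<le> ?Q"
    unfolding M_def
    by (rule functional_Santalo_half_space[OF IH B, where f=f and c=c and z=z])
      (use C zv dual' e1 in \<open>auto simp: H_def[of 1] L_UNIV L_exp M_def\<close>)
  then have 1: "?m * ?I 1 \<le> ?Q" unfolding H1 .
  have "(\<integral>\<^sup>+x. H (-1) x \<partial>M) * ?I (-1) \<le> ?Q"
    unfolding M_def
    by (rule functional_Santalo_half_space[OF IH B, where f=f and c=c and z=z])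
      (use C zv dual' e2 in \<open>auto simp: H_def[of "-1"] L_UNIV L_exp M_def\<close>)
  then have 2: "?m * ?I (-1) \<le> ?Q" unfolding H2 .
  have "(\<integral>\<^sup>+x. f x \<partial>M) * (\<integral>\<^sup>+y. g y \<partial>M) \<le> (\<integral>\<^sup>+x. f x \<partial>M) * (\<integral>\<^sup>+y. k y \<partial>M)"
    unfolding k_def M_def by (intro mult_left_mono bary) auto
  also have "(\<integral>\<^sup>+y. k y \<partial>M) = ?I 1 + ?I (-1)"
    unfolding M_def by (rule nn_integral_two_half_lines[symmetric]) (use B in auto)
  also have "(\<integral>\<^sup>+x. f x \<partial>M) * (?I 1 + ?I (-1)) = 2 * (?m * ?I 1 + ?m * ?I (-1))"
    unfolding N_UNIV[symmetric] c(2) by (simp only: distrib_left mult.assoc)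
  also have "\<dots> \<le> 2 * (?Q + ?Q)"
    by (intro mult_left_mono add_mono 1 2) auto
  \<comment> \<open>The mass of \<open>f\<close> is twice that of one half, and two halves are
    added, so the new coordinate contributes \<open>2 * 2 * (pi / 2) = 2 * pi\<close>.\<close>
  also have "\<dots> = ennreal (C * (2 * pi) ^ card (insert b B))"
  proof -
    define q where "q = C * (pi / 2) * (2 * pi) ^ card B"
    have "q \<ge> 0" using C by (simp add: q_def)
    then have "2 * (ennreal q + ennreal q) = ennreal 2 * ennreal (q + q)"
      by (simp only: ennreal_plus ennreal_numeral)
    also have "\<dots> = ennreal (2 * (q + q))"
      using \<open>q \<ge> 0\<close> by (intro ennreal_mult[symmetric]) auto
    also have "\<dots> = ennreal (C * (2 * pi) ^ card (insert b B))"
      using B by (simp add: q_def algebra_simps)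
    finally show ?thesis unfolding q_def .
  qed
  finally show ?thesis by (simp add: M_def)
qed

text \<open>The barycenter condition concerns only \<open>g\<close>, so cutting \<open>f\<close> off
  in height and in support preserves the hypotheses, and monotone convergence recovers
  \<open>f\<close>.\<close>

lemma functional_Santalo_insert:
  fixes b :: "'a::euclidean_space"
  assumes IH: "functional_Santalo B" and B: "finite B" "B \<subseteq> Basis" "b \<in> Basis" "b \<notin> B"
  shows "functional_Santalo (insert b B)"
  unfolding functional_Santalo_def
proof (intro allI impI)
  fix f g :: "'a \<Rightarrow> ennreal" and C :: real
  assume [measurable]: "f \<in> borel_measurable borel" "g \<in> borel_measurable borel" and C: "0 \<le> C"
    and dual: "\<forall>x\<in>coord_space (insert b B). \<forall>y\<in>coord_space (insert b B). f x * g y \<le> ennreal (C * exp (- (x \<bullet> y)))"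
    and bary: "\<forall>p. (\<integral>\<^sup>+y. g y \<partial>coord_lborel (insert b B))
      \<le> (\<integral>\<^sup>+y. ennreal (exp (p \<bullet> y)) * g y \<partial>coord_lborel (insert b B))"
  define h where "h n x = min (f x) (of_nat n) * indicator {x. norm x \<le> real n} x" for n x
  have h_le: "h n x \<le> f x" for n x by (simp add: h_def indicator_def)
  have [measurable]: "h n \<in> borel_measurable borel" for n unfolding h_def by measurable
  have mono: "incseq h"
  proof (intro incseq_SucI le_funI)
    fix n x
    have "min (f x) (of_nat n) \<le> min (f x) (of_nat (Suc n))"
      by (intro min.mono order_refl) (simp add: of_nat_mono)
    then show "h n x \<le> h (Suc n) x" by (auto simp: h_def indicator_def)
  qed
  have lim: "(\<lambda>n. h n x) \<longlonglongrightarrow> f x" for x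
  proof -
    have "(SUP n. of_nat n :: ennreal) = top" by (rule ennreal_SUP_of_nat_eq_top)
    moreover have "incseq (of_nat :: nat \<Rightarrow> ennreal)" by (auto simp: incseq_def of_nat_mono)
    ultimately have "(of_nat :: nat \<Rightarrow> ennreal) \<longlonglongrightarrow> top" using LIMSEQ_SUP by metis
    then have "(\<lambda>n. min (f x) (of_nat n)) \<longlonglongrightarrow> min (f x) top" by (intro tendsto_min tendsto_const)
    moreover obtain n0 where n0: "norm x \<le> real n0" using real_arch_simple by blast
    have "eventually (\<lambda>n. min (f x) (of_nat n) = h n x) sequentially"
      using eventually_ge_at_top[of n0] by eventually_elim (use n0 in \<open>auto simp: h_def indicator_def\<close>)
    ultimately have "(\<lambda>n. h n x) \<longlonglongrightarrow> min (f x) top" by (rule Lim_transform_eventually)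
    then show ?thesis by simp
  qed
  have "(\<integral>\<^sup>+x. h n x \<partial>coord_lborel (insert b B)) * (\<integral>\<^sup>+y. g y \<partial>coord_lborel (insert b B))
    \<le> ennreal (C * (2 * pi) ^ card (insert b B))" for n
  proof (rule functional_Santalo_insert_bounded[OF IH B])
    fix x y assume "x \<in> coord_space (insert b B)" "y \<in> coord_space (insert b B)"
    then show "h n x * g y \<le> ennreal (C * exp (- (x \<bullet> y)))"
      using dual by (intro order_trans[OF mult_right_mono[OF h_le]]) auto
  next
    show "h n x \<le> ennreal (real n)" for x
      by (auto simp: h_def indicator_def ennreal_of_nat_eq_real_of_nat)
    show "norm x > real n \<Longrightarrow> h n x = 0" for x by (simp add: h_def)
  qed (use C bary in auto)
  moreover have "(\<integral>\<^sup>+x. f x \<partial>coord_lborel (insert b B)) = (SUP n. \<integral>\<^sup>+x. h n x \<partial>coord_lborel (insert b B))"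
  proof -
    have "f x = (SUP n. h n x)" for x
      by (rule LIMSEQ_unique[OF lim LIMSEQ_SUP]) (use mono in \<open>auto simp: incseq_def le_fun_def\<close>)
    then show ?thesis
      using mono by (simp add: nn_integral_monotone_convergence_SUP)
  qed
  ultimately show "(\<integral>\<^sup>+x. f x \<partial>coord_lborel (insert b B)) * (\<integral>\<^sup>+y. g y \<partial>coord_lborel (insert b B))
    \<le> ennreal (C * (2 * pi) ^ card (insert b B))"
    by (auto simp: SUP_mult_right_ennreal intro: SUP_least)
qed

lemma functional_Santalo_coord:
  assumes "finite B" "B \<subseteq> Basis"
  shows "functional_Santalo B"
  using assms
proof (induction B rule: finite_induct)
  case empty
  then show ?case by (simp add: functional_Santalo_empty)
next
  case (insert b B)
  then show ?case by (intro functional_Santalo_insert) auto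
qed

lemma functional_Santalo_lborel:
  fixes f g :: "'a::euclidean_space \<Rightarrow> ennreal"
  assumes "f \<in> borel_measurable borel" "g \<in> borel_measurable borel"
    and "\<And>x y. f x * g y \<le> ennreal (exp (- (x \<bullet> y)))"
    and "\<And>p. (\<integral>\<^sup>+y. g y \<partial>lborel) \<le> (\<integral>\<^sup>+y. ennreal (exp (p \<bullet> y)) * g y \<partial>lborel)"
  shows "(\<integral>\<^sup>+x. f x \<partial>lborel) * (\<integral>\<^sup>+y. g y \<partial>lborel) \<le> ennreal ((2 * pi) ^ DIM('a))"
  using functional_SantaloD[OF functional_Santalo_coord[of Basis], of f g 1] assms
  by (simp add: coord_lborel_Basis)

subsection \<open>Lebesgue measurable functions\<close>

text \<open>A Borel version of \<open>f\<close> is set to \<open>0\<close> on a Borel null set that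
  contains all points of disagreement. The result lies below \<open>f\<close> everywhere, so an
  upper bound required at every point survives, which equality almost everywhere would not
  ensure.\<close>

lemma borel_minorant_lebesgue:
  fixes f :: "'a::euclidean_space \<Rightarrow> real"
  assumes f: "f \<in> borel_measurable lebesgue" and nn: "\<And>x. 0 \<le> f x"
  obtains f' where "f' \<in> borel_measurable borel" "\<And>x. 0 \<le> f' x" "\<And>x. f' x \<le> f x" "AE x in lborel. f x = f' x"
proof -
  obtain h where h[measurable]: "h \<in> borel_measurable borel" and eq: "AE x in lborel. f x = h x"
    using completion_ex_borel_measurable_real[OF f] by auto
  obtain E where E: "{x \<in> space lborel. f x \<noteq> h x} \<subseteq> E" "emeasure lborel E = 0" "E \<in> sets lborel"
    using eq by (auto elim: AE_E)
  have [measurable]: "E \<in> sets borel" using E by simp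
  have AE_E: "AE x in lborel. x \<notin> E" using E by (intro AE_not_in) (auto simp: null_sets_def)
  define f' where "f' x = h x * indicator (- E) x" for x
  have "f x = h x" if "x \<notin> E" for x using E(1) that by auto
  then have val: "f' x = (if x \<in> E then 0 else f x)" for x by (simp add: f'_def)
  show ?thesis
  proof (rule that[of f'])
    show "f' \<in> borel_measurable borel" unfolding f'_def by measurable
    show "AE x in lborel. f x = f' x" using AE_E by eventually_elim (simp add: val)
  qed (use nn in \<open>auto simp: val\<close>)
qed

text \<open>With respect to the measure of density \<open>g\<close>, the function
  \<open>p \<bullet> x\<close> has mean \<open>0\<close>, so the exponential bound applies. That
  measure may have infinite mass at this point, since integrability of \<open>norm x * g x\<close>
  does not control \<open>g\<close> near the origin.\<close>

lemma barycenter_imp_exp_le: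
  fixes g :: "real ^ 'n \<Rightarrow> real"
  assumes g[measurable]: "g \<in> borel_measurable lebesgue" and nn: "\<And>x. 0 \<le> g x" 
    and bary: "barycenter_at_origin g"
  shows "(\<integral>\<^sup>+y. ennreal (g y) \<partial>lebesgue) \<le> (\<integral>\<^sup>+y. ennreal (exp (p \<bullet> y)) * ennreal (g y) \<partial>lebesgue)"
proof -
  have p[measurable]: "(\<lambda>x. p \<bullet> x) \<in> borel_measurable lebesgue"
    by (rule measurable_completion) simp
  have i: "integrable lebesgue (\<lambda>x. g x *\<^sub>R x)"
  proof (rule Bochner_Integration.integrable_bound)
    show "integrable lebesgue (\<lambda>x. norm x * g x)"
      using bary by (simp add: barycenter_at_origin_def)
    show "(\<lambda>x. g x *\<^sub>R x) \<in> borel_measurable lebesgue"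
      by (rule borel_measurable_scaleR[OF g measurable_completion]) simp
  qed (simp add: nn mult.commute)
  let ?M = "density lebesgue (\<lambda>x. ennreal (g x))"
  have eq: "g x *\<^sub>R (p \<bullet> x) = p \<bullet> (g x *\<^sub>R x)" for x by simp
  have "integrable lebesgue (\<lambda>x. g x *\<^sub>R (p \<bullet> x))"
    unfolding eq by (rule integrable_inner_right) (rule i)
  then have "integrable ?M (\<lambda>x. p \<bullet> x)"
    using nn by (subst integrable_density) auto
  moreover have "(\<integral>x. p \<bullet> x \<partial>?M) = 0"
  proof -
    have "(\<integral>x. p \<bullet> x \<partial>?M) = (\<integral>x. g x *\<^sub>R (p \<bullet> x) \<partial>lebesgue)"
      using nn by (subst integral_density) auto
    also have "\<dots> = p \<bullet> (\<integral>x. g x *\<^sub>R x \<partial>lebesgue)"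
      unfolding eq by (rule integral_inner_right) (rule i)
    also have "\<dots> = 0" using bary by (simp add: barycenter_at_origin_def)
    finally show ?thesis .
  qed
  ultimately have "emeasure ?M (space ?M) \<le> (\<integral>\<^sup>+x. ennreal (exp (p \<bullet> x)) \<partial>?M)"
    by (rule emeasure_le_nn_integral_exp)
  then show ?thesis
    by (subst (asm) nn_integral_density) (auto simp: emeasure_density mult.commute)
qed

lemma functional_Santalo_barycenter:
  fixes f g :: "real ^ 'n \<Rightarrow> real"
  assumes f: "f \<in> borel_measurable lebesgue" and g: "g \<in> borel_measurable lebesgue"
    and nn: "\<And>x. 0 \<le> f x" "\<And>x. 0 \<le> g x"
    and duality: "\<And>x y. f x * g y \<le> exp (- (x \<bullet> y))"
    and bary: "barycenter_at_origin g"
  shows "(\<integral>\<^sup>+ x. ennreal (f x) \<partial>lebesgue) * (\<integral>\<^sup>+ y. ennreal (g y) \<partial>lebesgue)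
           \<le> ennreal ((2 * pi) ^ CARD('n))"
proof -
  obtain f' where f': "f' \<in> borel_measurable borel" "\<And>x. 0 \<le> f' x" "\<And>x. f' x \<le> f x" "AE x in lborel. f x = f' x"
    using borel_minorant_lebesgue[OF f nn(1)] by blast
  obtain g' where g': "g' \<in> borel_measurable borel" "\<And>x. 0 \<le> g' x" "\<And>x. g' x \<le> g x" "AE x in lborel. g x = g' x"
    using borel_minorant_lebesgue[OF g nn(2)] by blast
  note [measurable] = f'(1) g'(1)
  have If: "(\<integral>\<^sup>+x. ennreal (f x) \<partial>lebesgue) = (\<integral>\<^sup>+x. ennreal (f' x) \<partial>lborel)"
  proof -
    have "(\<integral>\<^sup>+x. ennreal (f x) \<partial>lebesgue) = (\<integral>\<^sup>+x. ennreal (f' x) \<partial>lebesgue)"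
      by (rule nn_integral_cong_AE, rule AE_completion) (use f'(4) in eventually_elim, simp)
    then show ?thesis by (simp add: nn_integral_completion)
  qed
  \<comment> \<open>A general weight \<open>k\<close> covers both uses: the constant
    \<open>1\<close> for the integral of \<open>g\<close> and an exponential for its tilted
    integral.\<close>
  have Ig: "(\<integral>\<^sup>+x. k x * ennreal (g x) \<partial>lebesgue) = (\<integral>\<^sup>+x. k x * ennreal (g' x) \<partial>lborel)"
    if [measurable]: "k \<in> borel_measurable borel" for k
  proof -
    have "(\<integral>\<^sup>+x. k x * ennreal (g x) \<partial>lebesgue) = (\<integral>\<^sup>+x. k x * ennreal (g' x) \<partial>lebesgue)"
      by (rule nn_integral_cong_AE, rule AE_completion) (use g'(4) in eventually_elim, simp)
    then show ?thesis by (simp add: nn_integral_completion)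
  qed
  have "(\<integral>\<^sup>+x. ennreal (f' x) \<partial>lborel) * (\<integral>\<^sup>+y. ennreal (g' y) \<partial>lborel) \<le> ennreal ((2 * pi) ^ DIM(real ^ 'n))"
  proof (rule functional_Santalo_lborel)
    fix x y
    have "f' x * g' y \<le> f x * g y" using f' g' nn by (intro mult_mono) auto
    also note duality
    finally show "ennreal (f' x) * ennreal (g' y) \<le> ennreal (exp (- (x \<bullet> y)))"
      using f' g' by (simp add: ennreal_mult[symmetric] ennreal_leI)
  next
    fix p
    show "(\<integral>\<^sup>+y. ennreal (g' y) \<partial>lborel) \<le> (\<integral>\<^sup>+y. ennreal (exp (p \<bullet> y)) * ennreal (g' y) \<partial>lborel)"
      using barycenter_imp_exp_le[OF g nn(2) bary, of p] Ig[of "\<lambda>_. 1"] Ig[of "\<lambda>y. ennreal (exp (p \<bullet> y))"] by simp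
  qed auto
  then show ?thesis using If Ig[of "\<lambda>_. 1"] by simp
qed

theorem theorem1:
  fixes f g :: "real ^ 'n \<Rightarrow> real"
  assumes f_meas: "f \<in> borel_measurable lebesgue"
    and g_meas: "g \<in> borel_measurable lebesgue"
    and f_nonneg: "\<And>x. 0 \<le> f x"
    and g_nonneg: "\<And>x. 0 \<le> g x"
    and duality: "\<And>x y. f x * g y \<le> exp (- (x \<bullet> y))"
    and barycenter: "barycenter_at_origin f \<or> barycenter_at_origin g"
  shows "(\<integral>\<^sup>+ x. ennreal (f x) \<partial>lebesgue) * (\<integral>\<^sup>+ y. ennreal (g y) \<partial>lebesgue)
           \<le> ennreal ((2 * pi) ^ CARD('n))"
  using barycenter
proof
  assume "barycenter_at_origin g"
  then show ?thesis
    by (rule functional_Santalo_barycenter[OF f_meas g_meas f_nonneg g_nonneg duality])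
next
  assume "barycenter_at_origin f"
  then have "(\<integral>\<^sup>+ y. ennreal (g y) \<partial>lebesgue) * (\<integral>\<^sup>+ x. ennreal (f x) \<partial>lebesgue)
      \<le> ennreal ((2 * pi) ^ CARD('n))"
  proof (intro functional_Santalo_barycenter g_meas f_meas g_nonneg f_nonneg)
    show "g y * f x \<le> exp (- (y \<bullet> x))" for x y
      using duality[of x y] by (simp add: mult.commute inner_commute[of y x])
  qed
  then show ?thesis by (simp add: mult.commute)
qed

end
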